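(* Consider a finite Markov decision process and the Generalized Q-learning iteration, both as specified in the context, with $N\ge1$ estimators, history length $K\ge1$, and a function $G:\mathbb{R}^{nNK}\to\mathbb{R}$ satisfying the following two conditions, where $Q=(Q_a^{ij})$ with $a\in\mathcal{A}$, $i\in\{1,\dots,N\}$, $j\in\{0,\dots,K-1\}$: (G1) if $Q_a^{ij}=Q_a^{kl}$ for all $i,k$, all $j,l$ and all $a$, then $G(Q)=\max_a Q_a^{ij}$; (G2) for all $Q,Q'\in\mathbb{R}^{nNK}$, $|G(Q)-G(Q')|\le\max_{a,i,j}|Q_a^{ij}-{Q'}_a^{ij}|$. Assume the step-sizes satisfy: there is a deterministic constant $C$ such that for every $(s,a)\in\mathcal{S}\times\mathcal{A}$ and $i\in\{1,\dots,N\}$, $0\le\alpha^i_{sa}(t)\le1$ for all $t$ and, with probability $1$, $$\sum_{t=0}^\infty(\alpha^i_{sa}(t))^2\le C,\qquad \sum_{t=0}^\infty\alpha^i_{sa}(t)=\infty .$$ Then, with probability $1$, $Q^i_{sa}(t)\to Q^*_{sa}$ as $t\to\infty$ for all $i\in\{1,\dots,N\}$ and all $(s,a)\in\mathcal{S}\times\mathcal{A}$, where $Q^*$ is the optimal action-value function, in either of the following cases: (i) $\gamma<1$; (ii) $\gamma=1$, there is an absorbing reward-free state $s_1$, the initial action values at $s_1$ are zero for all $a\in\mathcal{A}$ and all $i$, and all stationary policies are proper.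
   Context: **MDP.** $\mathcal{S}$ and $\mathcal{A}$ are finite sets, $|\mathcal{A}|=n$. For $s\in\mathcal{S}$, $a\in\mathcal{A}$, $p_{ss'}(a)\ge0$ with $\sum_{s'}p_{ss'}(a)=1$ are the transition probabilities, and $r_{sa}$ is a random reward with finite variance. $\gamma\in[0,1]$ is the discount factor. A stationary policy is a map $\pi:\mathcal{S}\to\mathcal{A}$; it induces a Markov chain with transition probabilities $p_{ss'}(\pi(s))$. The value $V^\pi_s$ is the limit as $T\to\infty$ of the expected sum $E[\sum_{t=0}^T\gamma^t r_{s_t,\pi(s_t)}\mid s_0=s]$ along this chain $(s_t)$, $V^*_s=\sup_\pi V^\pi_s$, and the optimal action-value function is $Q^*_{sa}=E[r_{sa}]+\gamma\sum_{s'}p_{ss'}(a)V^*_{s'}$. A state $s_1$ is absorbing and reward-free if $p_{s_1s_1}(a)=1$ and $r_{s_1a}=0$ for all $a$. A stationary policy is proper if, from every initial state, the probability of being at $s_1$ at time $t$ tends to $1$ as $t\to\infty$. **Generalized Q-learning (tabular).** There are $N$ action-value estimates $Q^1(t),\dots,Q^N(t)\in\mathbb{R}^{\mathcal{S}\times\mathcal{A}}$. Given initial values $Q^i(t)$ for $-K+1\le t\le0$, for $t\ge0$ and every $(s,a)$ and $i$, $$Q^i_{sa}(t+1)=Q^i_{sa}(t)+\alpha^i_{sa}(t)\big[r_{sa}(t)+\gamma\,Q^{GQ}_{f(s,a)}(t)-Q^i_{sa}(t)\big],$$ where $r_{sa}(t)$ is a random sample of the reward $r_{sa}$, $f(s,a)$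 is a random successor state sampled at time $t$, equal to $s'$ with probability $p_{ss'}(a)$, and $$Q^{GQ}_{s}(t)=G\big((Q^{i}_{sa}(t-j))_{a\in\mathcal{A},\,1\le i\le N,\,0\le j\le K-1}\big).$$ The step-size $\alpha^i_{sa}(t)$ is zero when $Q^i_{sa}$ is not updated at iteration $t$. All samples are drawn independently; $\alpha^i_{sa}(t)$ may be random but is measurable with respect to the history $\mathcal{F}(t)$ of the algorithm up to the selection of the step-sizes of iteration $t$ (before the samples of iteration $t$ are drawn). $\mathcal{F}(t)$ is increasing, the initial values are $\mathcal{F}(0)$-measurable, and the samples of iteration $t$ are $\mathcal{F}(t+1)$-measurable and, conditionally on $\mathcal{F}(t)$, have the stated laws. In case (ii) all initial values at $s_1$ (times $-K+1,\dots,0$) are zero. *)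

theory Defs
  imports "HOL-Probability.Probability"
begin

text \<open>
  A finite Markov decision process is given by finite types \<open>'s\<close> (states) and \<open>'a\<close> (actions),
  transition laws \<open>p s a\<close>, with \<open>pmf (p s a) s'\<close> the probability of moving from \<open>s\<close> to \<open>s'\<close> under
  \<open>a\<close>, and reward laws \<open>R s a\<close>, probability measures on the real line. A stationary policy is a
  function \<open>\<pi> :: 's \<Rightarrow> 'a\<close>.
\<close>

definition finite_variance_law :: "real measure \<Rightarrow> bool" where
  "finite_variance_law \<rho> \<longleftrightarrow>
     prob_space \<rho> \<and> sets \<rho> = sets borel \<and>
     integrable \<rho> (\<lambda>x. x) \<and> integrable \<rho> (\<lambda>x. (x - (\<integral>y. y \<partial>\<rho>))\<^sup>2)"

text \<open>Law of \<open>[s\<^sub>0, \<dots>, s\<^sub>T]\<close>, where \<open>(s\<^sub>t)\<close> is the chain induced by \<open>\<pi>\<close> and started at \<open>s\<^sub>0 = s\<close>.\<close>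

primrec path_pmf :: "('s \<Rightarrow> 'a \<Rightarrow> 's pmf) \<Rightarrow> ('s \<Rightarrow> 'a) \<Rightarrow> 's \<Rightarrow> nat \<Rightarrow> 's list pmf" where
  "path_pmf p \<pi> s 0 = return_pmf [s]"
| "path_pmf p \<pi> s (Suc T) =
     bind_pmf (path_pmf p \<pi> s T)
       (\<lambda>xs. map_pmf (\<lambda>x. xs @ [x]) (p (last xs) (\<pi> (last xs))))"

text \<open>
  The expectation over the chain and the rewards collected along it: given the path
  \<open>xs = [s\<^sub>0, \<dots>, s\<^sub>T]\<close>, the rewards \<open>\<rho> 0, \<dots>, \<rho> T\<close> are independent and \<open>\<rho> t\<close> has law
  \<open>R s\<^sub>t (\<pi> s\<^sub>t)\<close>.
\<close>

definition expected_return ::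
  "('s \<Rightarrow> 'a \<Rightarrow> 's pmf) \<Rightarrow> ('s \<Rightarrow> 'a \<Rightarrow> real measure) \<Rightarrow> real \<Rightarrow> ('s \<Rightarrow> 'a) \<Rightarrow> nat \<Rightarrow> 's \<Rightarrow> real"
where
  "expected_return p R \<gamma> \<pi> T s =
     measure_pmf.expectation (path_pmf p \<pi> s T)
       (\<lambda>xs. \<integral>\<rho>. (\<Sum>t\<le>T. \<gamma> ^ t * \<rho> t) \<partial>(\<Pi>\<^sub>M t\<in>{..T}. R (xs ! t) (\<pi> (xs ! t))))"

definition policy_value ::
  "('s \<Rightarrow> 'a \<Rightarrow> 's pmf) \<Rightarrow> ('s \<Rightarrow> 'a \<Rightarrow> real measure) \<Rightarrow> real \<Rightarrow> ('s \<Rightarrow> 'a) \<Rightarrow> 's \<Rightarrow> real" where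
  "policy_value p R \<gamma> \<pi> s = lim (\<lambda>T. expected_return p R \<gamma> \<pi> T s)"

definition opt_value ::
  "('s \<Rightarrow> 'a \<Rightarrow> 's pmf) \<Rightarrow> ('s \<Rightarrow> 'a \<Rightarrow> real measure) \<Rightarrow> real \<Rightarrow> 's \<Rightarrow> real" where
  "opt_value p R \<gamma> s = (SUP \<pi>. policy_value p R \<gamma> \<pi> s)"

definition opt_q ::
  "('s::finite \<Rightarrow> 'a \<Rightarrow> 's pmf) \<Rightarrow> ('s \<Rightarrow> 'a \<Rightarrow> real measure) \<Rightarrow> real \<Rightarrow> 's \<Rightarrow> 'a \<Rightarrow> real" where
  "opt_q p R \<gamma> s a =
     (\<integral>x. x \<partial>(R s a)) + \<gamma> * (\<Sum>s'\<in>UNIV. pmf (p s a) s' * opt_value p R \<gamma> s')"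

definition absorbing_reward_free ::
  "('s \<Rightarrow> 'a \<Rightarrow> 's pmf) \<Rightarrow> ('s \<Rightarrow> 'a \<Rightarrow> real measure) \<Rightarrow> 's \<Rightarrow> bool" where
  "absorbing_reward_free p R s\<^sub>1 \<longleftrightarrow>
     (\<forall>a. pmf (p s\<^sub>1 a) s\<^sub>1 = 1 \<and> (AE x in R s\<^sub>1 a. x = 0))"

definition proper_policy :: "('s \<Rightarrow> 'a \<Rightarrow> 's pmf) \<Rightarrow> 's \<Rightarrow> ('s \<Rightarrow> 'a) \<Rightarrow> bool" where
  "proper_policy p s\<^sub>1 \<pi> \<longleftrightarrow>
     (\<forall>s. (\<lambda>t. measure_pmf.prob (path_pmf p \<pi> s t) {xs. xs ! t = s\<^sub>1}) \<longlonglongrightarrow> 1)"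

text \<open>
  Conditionally on the sub-sigma-algebra \<open>H\<close> of \<open>M\<close>, the random variable \<open>X\<close> has the
  (non-random) law \<open>\<mu>\<close>.
\<close>

definition has_cond_law ::
  "'w measure \<Rightarrow> 'w measure \<Rightarrow> ('w \<Rightarrow> 'b) \<Rightarrow> 'b measure \<Rightarrow> bool" where
  "has_cond_law M H X \<mu> \<longleftrightarrow>
     X \<in> M \<rightarrow>\<^sub>M \<mu> \<and>
     (\<forall>B\<in>sets \<mu>. AE \<omega> in M. real_cond_exp M H (\<lambda>\<omega>. indicator B (X \<omega>)) \<omega> = measure \<mu> B)"

text \<open>
  A point of \<open>\<real>\<^bsup>nNK\<^esup>\<close> is rendered as a function \<open>X\<close> with entries \<open>X a i j\<close>, of which only those with
  \<open>i \<in> {1..N}\<close> and \<open>j < K\<close> are relevant: \<open>G_nonexpansive\<close> forces \<open>G\<close> to ignore all other entries.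
\<close>

definition G_consistent :: "nat \<Rightarrow> nat \<Rightarrow> (('a::finite \<Rightarrow> nat \<Rightarrow> nat \<Rightarrow> real) \<Rightarrow> real) \<Rightarrow> bool" where
  "G_consistent N K G \<longleftrightarrow>
     (\<forall>X. (\<forall>a. \<forall>i\<in>{1..N}. \<forall>k\<in>{1..N}. \<forall>j<K. \<forall>l<K. X a i j = X a k l) \<longrightarrow>
          (\<forall>i\<in>{1..N}. \<forall>j<K. G X = (MAX a. X a i j)))"

definition G_nonexpansive :: "nat \<Rightarrow> nat \<Rightarrow> (('a::finite \<Rightarrow> nat \<Rightarrow> nat \<Rightarrow> real) \<Rightarrow> real) \<Rightarrow> bool" where
  "G_nonexpansive N K G \<longleftrightarrow>
     (\<forall>X Y. \<bar>G X - G Y\<bar> \<le> (MAX (a, i, j)\<in>UNIV \<times> {1..N} \<times> {..<K}. \<bar>X a i j - Y a i j\<bar>))"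

end

theory Submission
  imports Defs
begin

text \<open>
  Nonnegative weights \<open>\<xi>\<close> with \<open>\<gamma> * (\<Sum>s'. pmf (p s a) s' * \<xi> s') \<le> \<beta> * \<xi> s\<close> for some \<open>\<beta> < 1\<close> make both
  the Bellman operators and the averaged updates of the iteration contractions in the weighted
  maximum norm. In case (i) \<open>\<xi> = 1\<close>; in case (ii) \<open>\<xi> s = 1 - \<epsilon> ^ d s\<close>, where \<open>d s\<close> is the rank of \<open>s\<close> in
  the attractor of \<open>s\<^sub>1\<close>, which exhausts the state space because otherwise some stationary policy
  would never reach \<open>s\<^sub>1\<close>.

  The weighted error \<open>e = (Q - Q*) / \<xi>\<close> then satisfies \<open>e(t + 1) = e(t) + a(t) (h(t) + w(t) - e(t))\<close>
  with \<open>\<bar>h(t)\<bar>\<close> at most \<open>\<beta>\<close> times the largest error in the last \<open>K\<close> steps. The noise \<open>w\<close> grows with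
  the iterates, but divided by \<open>b(t) = 1 + max\<close> (errors up to \<open>t\<close>) it has bounded predictable
  coefficients, so \<open>\<Sum>t. a(t) * w(t) / b(t)\<close> converges almost surely by Kolmogorov's maximal inequality.
  On each such path summation by parts shows first that \<open>b\<close> is bounded, hence that \<open>\<Sum>t. a(t) * w(t)\<close>
  converges, and then every eventual bound on the error can be improved by a fixed factor.
\<close>

section \<open>Asynchronous averaging with noise\<close>

text \<open>The obstacle is a circle: the variance of the noise is controlled only by the iterates,
  whose boundedness is itself to be shown. The scale \<open>b(t)\<close> breaks it because it is
  known at time \<open>t\<close>: dividing by it makes the coefficients of the noise bounded and
  predictable, and the deterministic bound on the sums of squared step-sizes then makes the second
  moments summable. On a path, a late tail of the normalized noise, multiplied back by the
  nondecreasing \<open>b\<close>, costs only a small multiple of the current \<open>b\<close>, which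
  the gap \<open>1 - \<beta>\<close> absorbs. Only scalar innovations occur. The value at the
  sampled successor is not a predictable factor times an innovation, but its deviation from the mean
  is a finite sum of such products, one centred indicator per possible successor. Weights have to be
  allowed to vanish: at an absorbing state with \<open>\<gamma> = 1\<close> no positive weight
  satisfies the inequality with \<open>\<beta> < 1\<close>. Rewards, values and estimates are zero
  there, so no error has to be contracted.\<close>

lemma abel_partial_sum_bound:
  fixes b x :: "nat \<Rightarrow> real"
  assumes mono: "\<And>n. b n \<le> b (Suc n)" and nonneg: "0 \<le> b 0"
    and partial: "\<And>n. \<bar>\<Sum>t<n. x t\<bar> \<le> \<delta>"
  shows "\<bar>\<Sum>t<Suc n. b t * x t\<bar> \<le> 2 * \<delta> * b n"
proof -
  have \<delta>: "0 \<le> \<delta>" using partial[of 0] by simp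
  have b: "0 \<le> b n" for n
    by (induction n) (use nonneg mono order_trans in blast)+
  \<comment> \<open>Summation by parts: each increment of \<open>b\<close> multiplies a partial sum
    of \<open>x\<close>, and by monotonicity these increments add up to
    \<open>b n - b 0\<close>.\<close>
  have step: "\<bar>(\<Sum>t<n. b t * x t) - b n * (\<Sum>t<n. x t)\<bar> \<le> \<delta> * (b n - b 0)" for n
  proof (induction n)
    case (Suc n)
    have "(\<Sum>t<Suc n. b t * x t) - b (Suc n) * (\<Sum>t<Suc n. x t) =
        ((\<Sum>t<n. b t * x t) - b n * (\<Sum>t<n. x t)) - (b (Suc n) - b n) * (\<Sum>t<Suc n. x t)"
      by (simp add: algebra_simps)
    moreover have "\<bar>(b (Suc n) - b n) * (\<Sum>t<Suc n. x t)\<bar> \<le> (b (Suc n) - b n) * \<delta>"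
      unfolding abs_mult using partial[of "Suc n"] mono[of n]
      by (intro mult_mono) auto
    ultimately show ?case using Suc by (simp only:) (simp add: algebra_simps)
  qed simp
  \<comment> \<open>The boundary term keeps \<open>b n\<close>, the last weight that occurs. A bound
    by \<open>b (Suc n)\<close> would be circular later, where this estimate controls the error at
    time \<open>Suc n\<close>, on which \<open>b (Suc n)\<close> depends.\<close>
  have "(\<Sum>t<Suc n. b t * x t) = ((\<Sum>t<n. b t * x t) - b n * (\<Sum>t<n. x t)) + b n * (\<Sum>t<Suc n. x t)"
    by (simp add: algebra_simps)
  moreover have "\<bar>b n * (\<Sum>t<Suc n. x t)\<bar> \<le> b n * \<delta>"
    unfolding abs_mult using partial[of "Suc n"] b[of n] by (intro mult_mono) auto
  moreover have "0 \<le> \<delta> * b 0" using \<delta> nonneg by simp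
  ultimately show ?thesis using step[of n] by (simp only:) (simp add: algebra_simps)
qed

lemma uniform_small_tails:
  fixes x :: "nat \<Rightarrow> 'k \<Rightarrow> real"
  assumes "finite I" and conv: "\<And>k. k \<in> I \<Longrightarrow> convergent (\<lambda>n. \<Sum>t<n. x t k)" and "0 < \<delta>"
  obtains s where "\<And>v k n. k \<in> I \<Longrightarrow> s \<le> v \<Longrightarrow> \<bar>\<Sum>t<n. x (v + t) k\<bar> \<le> \<delta>"
proof -
  have "\<forall>k\<in>I. \<exists>s. \<forall>v\<ge>s. \<forall>n. \<bar>\<Sum>t<n. x (v + t) k\<bar> \<le> \<delta>"
  proof
    fix k assume "k \<in> I"
    then have "Cauchy (\<lambda>n. \<Sum>t<n. x t k)" using conv convergent_Cauchy by blast
    then obtain s where s: "\<And>m n. m \<ge> s \<Longrightarrow> n \<ge> s \<Longrightarrow> \<bar>(\<Sum>t<m. x t k) - (\<Sum>t<n. x t k)\<bar> < \<delta>"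
      using \<open>0 < \<delta>\<close> unfolding Cauchy_def dist_real_def by metis
    have "\<bar>\<Sum>t<n. x (v + t) k\<bar> \<le> \<delta>" if "v \<ge> s" for v n
    proof -
      have "(\<Sum>t<v + n. x t k) = (\<Sum>t<v. x t k) + (\<Sum>t<n. x (v + t) k)"
        by (induction n) auto
      then show ?thesis using s[of "v + n" v] that by simp
    qed
    then show "\<exists>s. \<forall>v\<ge>s. \<forall>n. \<bar>\<Sum>t<n. x (v + t) k\<bar> \<le> \<delta>" by blast
  qed
  then obtain f where f: "\<And>k v n. k \<in> I \<Longrightarrow> f k \<le> v \<Longrightarrow> \<bar>\<Sum>t<n. x (v + t) k\<bar> \<le> \<delta>" by metis
  have "f k \<le> (\<Sum>k\<in>I. f k)" if "k \<in> I" for k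
    using \<open>finite I\<close> that by (simp add: member_le_sum)
  then show ?thesis using f that[of "\<Sum>k\<in>I. f k"] by (meson order_trans)
qed

lemma convex_step_bound:
  fixes a u c y :: real
  assumes "0 \<le> a" "a \<le> 1" "\<bar>u\<bar> \<le> c" "\<bar>y\<bar> \<le> c"
  shows "\<bar>(1 - a) * u + a * y\<bar> \<le> c"
proof -
  have "\<bar>(1 - a) * u + a * y\<bar> \<le> (1 - a) * \<bar>u\<bar> + a * \<bar>y\<bar>"
    using assms abs_triangle_ineq[of "(1 - a) * u" "a * y"] by (simp add: abs_mult)
  also have "\<dots> \<le> (1 - a) * c + a * c"
    using assms by (intro add_mono mult_left_mono) auto
  finally show ?thesis by (simp add: algebra_simps)
qed

text \<open>\<open>1 - a \<le> exp (- a)\<close> compares \<open>u n\<close> with \<open>u 0\<close>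
  times the exponential of minus the summed step-sizes, and divergence of the sum drives this to
  zero.\<close>

lemma averaging_tendsto_0:
  fixes a u :: "nat \<Rightarrow> real"
  assumes a: "\<And>t. 0 \<le> a t" "\<And>t. a t \<le> 1"
    and div: "filterlim (\<lambda>n. \<Sum>t<n. a t) at_top sequentially"
    and step: "\<And>t. u (Suc t) \<le> (1 - a t) * u t"
    and nonneg: "0 \<le> u 0" and "0 < \<epsilon>"
  shows "eventually (\<lambda>t. u t \<le> \<epsilon>) sequentially"
proof -
  have le: "u n \<le> u 0 * exp (- (\<Sum>t<n. a t))" for n
  proof (induction n)
    case (Suc n)
    have "u (Suc n) \<le> (1 - a n) * u n" by (rule step)
    also have "\<dots> \<le> (1 - a n) * (u 0 * exp (- (\<Sum>t<n. a t)))"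
      using Suc a by (intro mult_left_mono) auto
    also have "\<dots> \<le> exp (- a n) * (u 0 * exp (- (\<Sum>t<n. a t)))"
      using exp_ge_add_one_self[of "- a n"] nonneg by (intro mult_right_mono) auto
    also have "\<dots> = u 0 * exp (- (\<Sum>t<Suc n. a t))"
      by (simp add: exp_diff exp_minus field_simps)
    finally show ?case .
  qed simp
  have "((\<lambda>n. u 0 * exp (- (\<Sum>t<n. a t))) \<longlongrightarrow> u 0 * 0) sequentially"
    by (intro tendsto_intros filterlim_compose[OF exp_at_bot]
          filterlim_compose[OF filterlim_uminus_at_bot_at_top] div)
  then have "eventually (\<lambda>n. u 0 * exp (- (\<Sum>t<n. a t)) < \<epsilon>) sequentially"
    using \<open>0 < \<epsilon>\<close> by (auto dest: order_tendstoD)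
  then show ?thesis
    by eventually_elim (use le order_trans less_imp_le in blast)
qed

text \<open>A single sample path; probability survives only in the convergence hypothesis
  \<open>noise\<close>. The two bounds on the target \<open>h\<close> serve different stages.
  \<open>target_bound\<close> looks at the whole past and takes \<open>B \<ge> B\<^sub>0\<close>,
  where \<open>B\<^sub>0\<close> covers initial values before time 0 that a short history still
  reads. \<open>window_bound\<close> forgets everything before \<open>s\<close> and admits small
  \<open>B\<close>, once the history of length \<open>K\<close> lies after \<open>s\<close>.\<close>

locale async_averaging =
  fixes I :: "'k set" and e h w a :: "nat \<Rightarrow> 'k \<Rightarrow> real" and b :: "nat \<Rightarrow> real"
    and \<beta> B\<^sub>0 :: real and K :: nat
  assumes finite: "finite I"
    and step: "\<And>t k. k \<in> I \<Longrightarrow> e (Suc t) k = e t k + a t k * (h t k + w t k - e t k)"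
    and a: "\<And>t k. k \<in> I \<Longrightarrow> 0 \<le> a t k" "\<And>t k. k \<in> I \<Longrightarrow> a t k \<le> 1"
    and divergent: "\<And>k. k \<in> I \<Longrightarrow> filterlim (\<lambda>n. \<Sum>t<n. a t k) at_top sequentially"
    and \<beta>: "0 \<le> \<beta>" "\<beta> < 1"
    and target_bound: "\<And>t B k. k \<in> I \<Longrightarrow> B\<^sub>0 \<le> B \<Longrightarrow> (\<And>\<tau> l. l \<in> I \<Longrightarrow> \<tau> \<le> t \<Longrightarrow> \<bar>e \<tau> l\<bar> \<le> B) \<Longrightarrow> \<bar>h t k\<bar> \<le> \<beta> * B"
    and window_bound: "\<And>s t B k. k \<in> I \<Longrightarrow> 0 \<le> B \<Longrightarrow> s + K \<le> t \<Longrightarrow>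
      (\<And>\<tau> l. l \<in> I \<Longrightarrow> s \<le> \<tau> \<Longrightarrow> \<tau> \<le> t \<Longrightarrow> \<bar>e \<tau> l\<bar> \<le> B) \<Longrightarrow> \<bar>h t k\<bar> \<le> \<beta> * B"
    and scale: "\<And>t. 0 < b t" "\<And>t. b t \<le> b (Suc t)"
      "\<And>t B. B\<^sub>0 \<le> B \<Longrightarrow> (\<And>\<tau> l. l \<in> I \<Longrightarrow> \<tau> \<le> t \<Longrightarrow> \<bar>e \<tau> l\<bar> \<le> B) \<Longrightarrow> b t \<le> 1 + B"
    and noise: "\<And>k. k \<in> I \<Longrightarrow> convergent (\<lambda>n. \<Sum>t<n. a t k * w t k / b t)"
begin

definition noise_sum :: "nat \<Rightarrow> nat \<Rightarrow> 'k \<Rightarrow> real" where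
  "noise_sum s n k = (\<Sum>t<n. a (s + t) k * w (s + t) k)"

lemma noise_sum_bound:
  assumes "\<And>n. \<bar>\<Sum>t<n. a (s + t) k * w (s + t) k / b (s + t)\<bar> \<le> \<delta>"
  shows "\<bar>noise_sum s (Suc n) k\<bar> \<le> 2 * \<delta> * b (s + n)"
proof -
  have nz: "b t \<noteq> 0" for t using scale(1)[of t] by simp
  have "noise_sum s (Suc n) k = (\<Sum>t<Suc n. b (s + t) * (a (s + t) k * w (s + t) k / b (s + t)))"
    unfolding noise_sum_def using nz by (intro sum.cong) auto
  then show ?thesis
    using abel_partial_sum_bound[of "\<lambda>n. b (s + n)" "\<lambda>t. a (s + t) k * w (s + t) k / b (s + t)" \<delta> n]
      scale(1)[of s] scale(2) assms by auto
qed

text \<open>Subtracting the accumulated noise turns the recursion into exact averaging.\<close>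

lemma denoised_step:
  assumes "k \<in> I"
  shows "e (s + Suc n) k - noise_sum s (Suc n) k =
    (1 - a (s + n) k) * (e (s + n) k - noise_sum s n k) + a (s + n) k * (h (s + n) k - noise_sum s n k)"
  using step[OF assms, of "s + n"] by (simp add: noise_sum_def algebra_simps)

text \<open>If the errors up to \<open>s + n\<close> are at most \<open>B - 1\<close>, then
  \<open>b (s + n) \<le> B\<close>, the noise accumulated since \<open>s\<close> is at most
  \<open>2 * \<delta> * B\<close>, and the denoised error is an average of quantities bounded by
  \<open>c'\<close>. The constants make this reproduce \<open>B - 1\<close> at the next
  time.\<close>

lemma bounded:
  obtains B where "B\<^sub>0 \<le> B" "0 \<le> B" "\<And>t. b t \<le> B" "\<And>t k. k \<in> I \<Longrightarrow> \<bar>e t k\<bar> \<le> B"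
proof -
  \<comment> \<open>The noise bound \<open>2 * (\<delta> * B)\<close> is paid twice, inside
    \<open>c'\<close> and when the noise is added back. With an eighth, both payments make up half
    of \<open>(1 - \<beta>) * B = 2 * (M + 1)\<close>; the other half is at least 1 and leaves
    \<open>B - 1\<close>.\<close>
  define \<delta> where "\<delta> = (1 - \<beta>) / 8"
  have "0 < \<delta>" using \<beta> by (simp add: \<delta>_def)
  obtain s where s: "\<And>v k n. k \<in> I \<Longrightarrow> s \<le> v \<Longrightarrow>
      \<bar>\<Sum>t<n. a (v + t) k * w (v + t) k / b (v + t)\<bar> \<le> \<delta>"
    using uniform_small_tails[where I = I and x = "\<lambda>t k. a t k * w t k / b t" and \<delta> = \<delta>, OF finite noise] \<open>0 < \<delta>\<close> by blast
  define M where "M = \<bar>B\<^sub>0\<bar> + (\<Sum>t\<le>s. \<Sum>k\<in>I. \<bar>e t k\<bar>)"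
  have M: "\<bar>e t k\<bar> \<le> M" if "t \<le> s" "k \<in> I" for t k
  proof -
    have "\<bar>e t k\<bar> \<le> (\<Sum>k\<in>I. \<bar>e t k\<bar>)" using finite that by (intro member_le_sum) auto
    also have "\<dots> \<le> (\<Sum>t\<le>s. \<Sum>k\<in>I. \<bar>e t k\<bar>)"
      using that by (intro member_le_sum[of t "{..s}" "\<lambda>t. \<Sum>k\<in>I. \<bar>e t k\<bar>"]) (auto intro: sum_nonneg)
    finally show ?thesis by (simp add: M_def)
  qed
  have M0: "0 \<le> M" "B\<^sub>0 \<le> M" by (auto simp: M_def intro!: add_nonneg_nonneg sum_nonneg)
     (smt (verit) sum_nonneg abs_ge_zero)
  define B where "B = 2 * (M + 1) / (1 - \<beta>)"
  have B1: "(1 - \<beta>) * B = 2 * (M + 1)" using \<beta> by (simp add: B_def)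
  have B2: "2 * (M + 1) \<le> B" using \<beta> M0 by (simp add: B_def field_simps)
  have B3: "8 * (\<delta> * B) = 2 * (M + 1)" using B1 by (simp add: \<delta>_def)
  have B4: "B = \<beta> * B + 2 * (M + 1)" using B1 by (simp add: algebra_simps)
  have "0 \<le> \<beta> * B" using \<beta> B2 M0 by simp
  define c' where "c' = max M (\<beta> * B + 2 * (\<delta> * B))"
  \<comment> \<open>\<open>B - 1\<close> instead of \<open>B\<close>, since the scale may exceed the
    largest error by 1.\<close>
  have main: "(\<forall>\<tau>\<le>s + n. \<forall>k\<in>I. \<bar>e \<tau> k\<bar> \<le> B - 1) \<and>
      (\<forall>k\<in>I. \<bar>e (s + n) k - noise_sum s n k\<bar> \<le> c' \<and> \<bar>noise_sum s n k\<bar> \<le> 2 * (\<delta> * B))" for n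
  proof (induction n)
    case 0
    have MB: "M \<le> B - 1" using B2 M0 by (simp add: algebra_simps)
    have "\<bar>e \<tau> k\<bar> \<le> B - 1" if "\<tau> \<le> s" "k \<in> I" for \<tau> k using M[OF that] MB by (rule order_trans)
    moreover have "\<bar>e s k\<bar> \<le> c'" if "k \<in> I" for k using M[OF order_refl that] by (simp add: c'_def)
    ultimately show ?case using B3 M0 by (simp add: noise_sum_def)
  next
    case (Suc n)
    have bB: "b (s + n) \<le> B"
      using scale(3)[of "B - 1" "s + n"] Suc B2 M0 by (auto simp: algebra_simps)
    have "\<bar>e (s + Suc n) k\<bar> \<le> B - 1 \<and> \<bar>e (s + Suc n) k - noise_sum s (Suc n) k\<bar> \<le> c' \<and>
        \<bar>noise_sum s (Suc n) k\<bar> \<le> 2 * (\<delta> * B)" if k: "k \<in> I" for k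
    proof -
      have "\<bar>noise_sum s (Suc n) k\<bar> \<le> 2 * \<delta> * b (s + n)"
        by (rule noise_sum_bound) (use s k in auto)
      also have "\<dots> \<le> 2 * \<delta> * B" using bB \<open>0 < \<delta>\<close> by simp
      finally have n1: "\<bar>noise_sum s (Suc n) k\<bar> \<le> 2 * (\<delta> * B)" by simp
      have "\<bar>h (s + n) k\<bar> \<le> \<beta> * (B - 1)"
        using target_bound[OF k, of "B - 1" "s + n"] Suc B2 M0 by auto
      also have "\<dots> \<le> \<beta> * B" using \<beta> by (simp add: algebra_simps)
      finally have "\<bar>h (s + n) k - noise_sum s n k\<bar> \<le> c'" using Suc k by (force simp: c'_def)
      then have n2: "\<bar>e (s + Suc n) k - noise_sum s (Suc n) k\<bar> \<le> c'"
        unfolding denoised_step[OF k] using Suc k a[OF k] by (intro convex_step_bound) auto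
      have "c' + 2 * (\<delta> * B) \<le> B - 1"
        unfolding c'_def max_def
        using B3 B4 M0(1) \<open>0 \<le> \<beta> * B\<close> by (smt (verit))
      with n1 n2 show ?thesis by linarith
    qed
    with Suc show ?case by (auto simp: le_Suc_eq)
  qed
  have "b t \<le> B" for t
    using scale(3)[of "B - 1" t] main[of t] B2 M0 by (auto simp: algebra_simps)
  moreover have "\<bar>e t k\<bar> \<le> B" if "k \<in> I" for t k
    using main[of t] that by (smt (verit) le_add2)
  moreover have "B\<^sub>0 \<le> B" "0 \<le> B" using B2 M0 by (simp_all add: algebra_simps)
  ultimately show ?thesis using that by blast
qed

text \<open>With \<open>b\<close> bounded, the summation by parts behind \<open>bounded\<close>
  makes the tails of the unnormalized noise small as well.\<close>

lemma noise_sum_small: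
  assumes "0 < \<delta>"
  obtains s where "\<And>v k n. k \<in> I \<Longrightarrow> s \<le> v \<Longrightarrow> \<bar>noise_sum v n k\<bar> \<le> \<delta>"
proof -
  obtain B where B: "0 \<le> B" "\<And>t. b t \<le> B" using bounded by metis
  define \<delta>' where "\<delta>' = \<delta> / (2 * (B + 1))"
  have "0 < \<delta>'" using assms B by (simp add: \<delta>'_def)
  then obtain s where s: "\<And>v k n. k \<in> I \<Longrightarrow> s \<le> v \<Longrightarrow>
      \<bar>\<Sum>t<n. a (v + t) k * w (v + t) k / b (v + t)\<bar> \<le> \<delta>'"
    using uniform_small_tails[where I = I and x = "\<lambda>t k. a t k * w t k / b t" and \<delta> = \<delta>', OF finite noise] by blast
  have "\<bar>noise_sum v n k\<bar> \<le> \<delta>" if "k \<in> I" "s \<le> v" for v k n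
  proof (cases n)
    case 0
    then show ?thesis using assms by (simp add: noise_sum_def)
  next
    case (Suc m)
    have "\<bar>noise_sum v n k\<bar> \<le> 2 * \<delta>' * b (v + m)"
      unfolding Suc by (rule noise_sum_bound) (use s that in auto)
    also have "\<dots> \<le> 2 * \<delta>' * (B + 1)"
      using \<open>0 < \<delta>'\<close> B(2)[of "v + m"] by (intro mult_left_mono) auto
    also have "\<dots> = \<delta>" using B by (simp add: \<delta>'_def field_simps)
    finally show ?thesis .
  qed
  then show ?thesis using that by blast
qed

text \<open>Once the history lies where errors are at most \<open>D\<close>, the target is at most
  \<open>\<beta> * D\<close>. Averaging with divergent step-sizes pulls the denoised error down to
  about that level, and noise accumulated from a late start is negligible.\<close>

lemma contraction_step:
  assumes "0 < D" and ev: "eventually (\<lambda>t. \<forall>k\<in>I. \<bar>e t k\<bar> \<le> D) sequentially"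
  shows "eventually (\<lambda>t. \<forall>k\<in>I. \<bar>e t k\<bar> \<le> (1 + \<beta>) / 2 * D) sequentially"
proof -
  \<comment> \<open>There are three losses of \<open>\<delta>\<close>: noise in the averaged target,
    unfinished averaging, and noise added back. Together they use half of the gap
    \<open>(1 - \<beta>) * D\<close>.\<close>
  define \<delta> where "\<delta> = (1 - \<beta>) * D / 6"
  have "0 < \<delta>" using \<beta> \<open>0 < D\<close> by (simp add: \<delta>_def)
  obtain s\<^sub>1 where s1: "\<And>t k. t \<ge> s\<^sub>1 \<Longrightarrow> k \<in> I \<Longrightarrow> \<bar>e t k\<bar> \<le> D"
    using ev by (auto simp: eventually_sequentially)
  obtain s\<^sub>2 where s2: "\<And>v k n. k \<in> I \<Longrightarrow> s\<^sub>2 \<le> v \<Longrightarrow> \<bar>noise_sum v n k\<bar> \<le> \<delta>"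
    using noise_sum_small[OF \<open>0 < \<delta>\<close>] by blast
  define s where "s = s\<^sub>1 + s\<^sub>2 + K"
  have h: "\<bar>h (s + n) k\<bar> \<le> \<beta> * D" if "k \<in> I" for n k
    using window_bound[of k D s\<^sub>1 "s + n"] that s1 \<open>0 < D\<close> by (auto simp: s_def)
  have "eventually (\<lambda>t. \<bar>e t k\<bar> \<le> (1 + \<beta>) / 2 * D) sequentially" if k: "k \<in> I" for k
  proof -
    \<comment> \<open>Subtracting the bound on the averaged target makes the recursion for the
      excess homogeneous.\<close>
    define U where "U n = \<bar>e (s + n) k - noise_sum s n k\<bar> - (\<beta> * D + \<delta>)" for n
    have st: "U (Suc n) \<le> (1 - a (s + n) k) * U n" for n
    proof -
      let ?u = "e (s + n) k - noise_sum s n k" and ?y = "h (s + n) k - noise_sum s n k"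
        and ?a = "a (s + n) k"
      have y: "\<bar>?y\<bar> \<le> \<beta> * D + \<delta>" using h[OF k, of n] s2[OF k, of s n] by (simp add: s_def)
      have "\<bar>(1 - ?a) * ?u + ?a * ?y\<bar> \<le> (1 - ?a) * \<bar>?u\<bar> + ?a * \<bar>?y\<bar>"
        using a[OF k, of "s + n"] abs_triangle_ineq[of "(1 - ?a) * ?u" "?a * ?y"]
        by (simp add: abs_mult)
      also have "\<dots> \<le> (1 - ?a) * \<bar>?u\<bar> + ?a * (\<beta> * D + \<delta>)"
        using y a[OF k, of "s + n"] by (intro add_left_mono mult_left_mono) auto
      finally show ?thesis unfolding U_def denoised_step[OF k] by (simp add: algebra_simps)
    qed
    have "filterlim (\<lambda>n. - (\<Sum>t<s. a t k) + (\<Sum>t<n + s. a t k)) at_top sequentially"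
      by (intro filterlim_tendsto_add_at_top[OF tendsto_const]
            filterlim_compose[OF divergent[OF k]] filterlim_add_const_nat_at_top)
    moreover have "(\<Sum>t<n + s. a t k) = (\<Sum>t<s. a t k) + (\<Sum>t<n. a (s + t) k)" for n
      by (induction n) (auto simp: add.commute)
    ultimately have div: "filterlim (\<lambda>n. \<Sum>t<n. a (s + t) k) at_top sequentially" by simp
    \<comment> \<open>The positive part, since the comparison with an exponential needs a
      nonnegative start.\<close>
    have "eventually (\<lambda>n. max (U n) 0 \<le> \<delta>) sequentially"
    proof (rule averaging_tendsto_0[of "\<lambda>n. a (s + n) k"])
      show "max (U (Suc t)) 0 \<le> (1 - a (s + t) k) * max (U t) 0" for t
      proof -
        have "(1 - a (s + t) k) * U t \<le> (1 - a (s + t) k) * max (U t) 0"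
          using a[OF k, of "s + t"] by (intro mult_left_mono) auto
        moreover have "0 \<le> (1 - a (s + t) k) * max (U t) 0"
          using a[OF k, of "s + t"] by simp
        ultimately show ?thesis using st[of t] by simp
      qed
    qed (use a[OF k] div \<open>0 < \<delta>\<close> in auto)
    then obtain n\<^sub>0 where n0: "\<And>n. n \<ge> n\<^sub>0 \<Longrightarrow> U n \<le> \<delta>"
      by (auto simp: eventually_sequentially)
    have "\<bar>e t k\<bar> \<le> (1 + \<beta>) / 2 * D" if "t \<ge> s + n\<^sub>0" for t
    proof -
      have "U (t - s) \<le> \<delta>" "s + (t - s) = t" using that by (auto intro: n0)
      then have "\<bar>e t k - noise_sum s (t - s) k\<bar> \<le> \<beta> * D + 2 * \<delta>" by (simp add: U_def)
      moreover have "\<bar>noise_sum s (t - s) k\<bar> \<le> \<delta>" using s2[OF k] by (simp add: s_def)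
      ultimately have "\<bar>e t k\<bar> \<le> \<beta> * D + 3 * \<delta>" by linarith
      also have "\<dots> = (1 + \<beta>) / 2 * D" by (simp add: \<delta>_def field_simps)
      finally show ?thesis .
    qed
    then show ?thesis by (auto simp: eventually_sequentially)
  qed
  then show ?thesis by (simp add: eventually_ball_finite_distrib finite)
qed

theorem tendsto_0:
  assumes "k \<in> I"
  shows "(\<lambda>t. e t k) \<longlonglongrightarrow> 0"
proof -
  obtain B where B: "0 \<le> B" "\<And>t k. k \<in> I \<Longrightarrow> \<bar>e t k\<bar> \<le> B" using bounded by metis
  have ev: "eventually (\<lambda>t. \<forall>k\<in>I. \<bar>e t k\<bar> \<le> ((1 + \<beta>) / 2) ^ n * (B + 1)) sequentially" for n
  proof (induction n)
    case 0
    show ?case using B(2) by (auto intro!: always_eventually simp: add_increasing2)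
  next
    case (Suc n)
    then show ?case using contraction_step[OF _ Suc] B(1) \<beta> by (simp add: mult_ac)
  qed
  have "(\<lambda>n. ((1 + \<beta>) / 2) ^ n * (B + 1)) \<longlonglongrightarrow> 0 * (B + 1)"
    using \<beta> by (intro tendsto_intros LIMSEQ_power_zero) auto
  then have lim: "\<exists>n. ((1 + \<beta>) / 2) ^ n * (B + 1) < \<epsilon>" if "0 < \<epsilon>" for \<epsilon>
    using that order_tendstoD(2)[of _ _ sequentially \<epsilon>] by (fastforce simp: eventually_sequentially)
  show ?thesis
  proof (rule tendstoI)
    fix \<epsilon> :: real assume "0 < \<epsilon>"
    then obtain n where n: "((1 + \<beta>) / 2) ^ n * (B + 1) < \<epsilon>" using lim by blast
    from ev[of n] show "eventually (\<lambda>t. dist (e t k) 0 < \<epsilon>) sequentially"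
      by eventually_elim (use n assms in \<open>force simp: dist_real_def\<close>)
  qed
qed

end

section \<open>Predictable transforms of independent innovations\<close>

text \<open>Independence is required against each real random variable known at time
  \<open>t\<close>. Applied to squares of coefficients and to products with the past transform, it
  does the work of conditional expectations.\<close>

locale independent_innovations = prob_space M for M :: "'w measure" +
  fixes F :: "nat \<Rightarrow> 'w measure" and z :: "nat \<Rightarrow> 'w \<Rightarrow> real" and v :: real
  assumes subalgebra: "\<And>t. subalgebra M (F t)"
    and F_mono: "\<And>s t. s \<le> t \<Longrightarrow> sets (F s) \<subseteq> sets (F t)"
    and z_adapted: "\<And>t. z t \<in> borel_measurable (F (Suc t))"
    and z_square: "\<And>t. integrable M (\<lambda>\<omega>. (z t \<omega>)\<^sup>2)"
    and z_mean: "\<And>t. expectation (z t) = 0"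
    and z_second_moment: "\<And>t. expectation (\<lambda>\<omega>. (z t \<omega>)\<^sup>2) \<le> v"
    and z_indep: "\<And>t Y. Y \<in> borel_measurable (F t) \<Longrightarrow> indep_var borel Y borel (z t)"
begin

lemma measurable_F_mono:
  assumes "s \<le> t" "Y \<in> borel_measurable (F s)"
  shows "Y \<in> borel_measurable (F t)"
  by (rule measurable_from_subalg[OF _ assms(2)])
    (use subalgebra[of s] subalgebra[of t] F_mono[OF assms(1)] in \<open>simp add: subalgebra_def\<close>)

lemma measurable_F:
  assumes "Y \<in> borel_measurable (F s)"
  shows "Y \<in> borel_measurable M"
  using measurable_from_subalg[OF subalgebra assms] .

lemma z_measurable [measurable]: "z t \<in> borel_measurable M"
  by (rule measurable_F[OF z_adapted])

lemma z_integrable: "integrable M (z t)"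
  by (rule square_integrable_imp_integrable[OF z_measurable z_square])

lemma v_nonneg: "0 \<le> v"
  by (rule order_trans[OF _ z_second_moment[of 0]]) simp

text \<open>The martingale transform of \<open>z\<close> by \<open>g\<close>, started at
  \<open>m\<close>; its value at \<open>n\<close> involves only innovations before
  \<open>n\<close>.\<close>

definition transform :: "(nat \<Rightarrow> 'w \<Rightarrow> real) \<Rightarrow> nat \<Rightarrow> nat \<Rightarrow> 'w \<Rightarrow> real" where
  "transform g m n \<omega> = (\<Sum>t\<in>{m..<n}. g t \<omega> * z t \<omega>)"

lemma transform_Suc: "m \<le> n \<Longrightarrow> transform g m (Suc n) \<omega> = transform g m n \<omega> + g n \<omega> * z n \<omega>"
  by (simp add: transform_def)

context
  fixes g :: "nat \<Rightarrow> 'w \<Rightarrow> real" and c :: real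
  assumes g_predictable: "\<And>t. g t \<in> borel_measurable (F t)"
    and g_bounded: "\<And>t \<omega>. \<omega> \<in> space M \<Longrightarrow> \<bar>g t \<omega>\<bar> \<le> c"
begin

lemma g_measurable: "g t \<in> borel_measurable M"
  by (rule measurable_F[OF g_predictable])

lemma transform_adapted: "transform g m n \<in> borel_measurable (F n)"
  unfolding transform_def
  by (intro borel_measurable_sum borel_measurable_times measurable_F_mono[OF _ g_predictable]
      measurable_F_mono[OF _ z_adapted]) auto

lemma transform_measurable: "transform g m n \<in> borel_measurable M"
  by (rule measurable_F[OF transform_adapted])

lemma integrable_g_times:
  assumes "integrable M X"
  shows "integrable M (\<lambda>\<omega>. X \<omega> * g t \<omega>)"
proof (rule Bochner_Integration.integrable_bound)
  show "integrable M (\<lambda>\<omega>. c * X \<omega>)" using assms by simp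
  show "(\<lambda>\<omega>. X \<omega> * g t \<omega>) \<in> borel_measurable M"
    using borel_measurable_integrable[OF assms] g_measurable by (rule borel_measurable_times)
  have "\<bar>X \<omega> * g t \<omega>\<bar> \<le> \<bar>c * X \<omega>\<bar>" if "\<omega> \<in> space M" for \<omega>
    using g_bounded[OF that, of t] mult_mono[of "\<bar>X \<omega>\<bar>" "\<bar>X \<omega>\<bar>" "\<bar>g t \<omega>\<bar>" "\<bar>c\<bar>"]
    by (simp add: abs_mult mult.commute)
  then show "AE \<omega> in M. norm (X \<omega> * g t \<omega>) \<le> norm (c * X \<omega>)" by auto
qed

lemma integrable_g_square: "integrable M (\<lambda>\<omega>. (g t \<omega>)\<^sup>2)"
  using integrable_g_times[OF integrable_g_times[of "\<lambda>_. 1" t], of t]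
  by (simp add: power2_eq_square)

lemma transform_integrable: "integrable M (transform g m n)"
  unfolding transform_def
  by (subst mult.commute) (intro Bochner_Integration.integrable_sum integrable_g_times z_integrable)

text \<open>\<open>z\<close> may be unbounded, but its square is independent of the square of the
  bounded coefficient, so the second moment factorizes.\<close>

lemma increment_square:
  "integrable M (\<lambda>\<omega>. (g t \<omega> * z t \<omega>)\<^sup>2)"
  "expectation (\<lambda>\<omega>. (g t \<omega> * z t \<omega>)\<^sup>2) \<le> v * expectation (\<lambda>\<omega>. (g t \<omega>)\<^sup>2)"
proof -
  have "indep_var borel (\<lambda>\<omega>. (g t \<omega>)\<^sup>2) borel (\<lambda>\<omega>. (z t \<omega>)\<^sup>2)"
    using indep_var_compose[OF z_indep[OF g_predictable[of t]], of "\<lambda>x. x\<^sup>2" borel "\<lambda>x. x\<^sup>2" borel]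
    by (simp add: comp_def)
  note * = indep_var_integrable[OF this integrable_g_square z_square]
    indep_var_lebesgue_integral[OF this integrable_g_square z_square]
  show "integrable M (\<lambda>\<omega>. (g t \<omega> * z t \<omega>)\<^sup>2)" using * by (simp add: power_mult_distrib)
  have "expectation (\<lambda>\<omega>. (g t \<omega> * z t \<omega>)\<^sup>2) =
      expectation (\<lambda>\<omega>. (g t \<omega>)\<^sup>2) * expectation (\<lambda>\<omega>. (z t \<omega>)\<^sup>2)"
    using * by (simp add: power_mult_distrib)
  also have "\<dots> \<le> expectation (\<lambda>\<omega>. (g t \<omega>)\<^sup>2) * v"
    by (intro mult_left_mono z_second_moment integral_nonneg) auto
  finally show "expectation (\<lambda>\<omega>. (g t \<omega> * z t \<omega>)\<^sup>2) \<le> v * expectation (\<lambda>\<omega>. (g t \<omega>)\<^sup>2)"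
    by (simp add: mult.commute)
qed

text \<open>Orthogonality of increments: in the cross term, the past transform times
  \<open>g n\<close> is known at time \<open>n\<close>, hence independent of the centred
  \<open>z n\<close>.\<close>

lemma transform_second_moment:
  assumes "m \<le> n"
  shows "integrable M (\<lambda>\<omega>. (transform g m n \<omega>)\<^sup>2) \<and>
    expectation (\<lambda>\<omega>. (transform g m n \<omega>)\<^sup>2) \<le> v * (\<Sum>t\<in>{m..<n}. expectation (\<lambda>\<omega>. (g t \<omega>)\<^sup>2))"
  using assms
proof (induction n rule: dec_induct)
  case base
  then show ?case by (simp add: transform_def)
next
  case (step n)
  let ?S = "transform g m n" and ?d = "\<lambda>\<omega>. g n \<omega> * z n \<omega>"
  have Yg: "(\<lambda>\<omega>. ?S \<omega> * g n \<omega>) \<in> borel_measurable (F n)"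
    by (intro borel_measurable_times transform_adapted g_predictable)
  have int: "integrable M (\<lambda>\<omega>. ?S \<omega> * g n \<omega>)"
    by (rule integrable_g_times[OF transform_integrable])
  have cross: "integrable M (\<lambda>\<omega>. ?S \<omega> * ?d \<omega>)" "expectation (\<lambda>\<omega>. ?S \<omega> * ?d \<omega>) = 0"
    using indep_var_integrable[OF z_indep[OF Yg] int z_integrable]
      indep_var_lebesgue_integral[OF z_indep[OF Yg] int z_integrable]
    by (simp_all add: z_mean mult.assoc)
  have *: "(transform g m (Suc n) \<omega>)\<^sup>2 = ((?S \<omega>)\<^sup>2 + 2 * (?S \<omega> * ?d \<omega>)) + (?d \<omega>)\<^sup>2" for \<omega>
    using step by (simp add: transform_Suc power2_sum)
  have "expectation (\<lambda>\<omega>. (transform g m (Suc n) \<omega>)\<^sup>2) =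
      expectation (\<lambda>\<omega>. (?S \<omega>)\<^sup>2) + expectation (\<lambda>\<omega>. (?d \<omega>)\<^sup>2)"
    unfolding * using step cross increment_square(1)[of n] by simp
  then show ?case
    using step cross(1) increment_square[of n] unfolding *
    by (simp add: algebra_simps)
qed

text \<open>Here it matters that \<open>C\<close> is deterministic: an almost sure bound by a
  constant passes to the expectations of the partial sums.\<close>

lemma expectation_g_square_sum:
  assumes "AE \<omega> in M. summable (\<lambda>t. (g t \<omega>)\<^sup>2) \<and> (\<Sum>t. (g t \<omega>)\<^sup>2) \<le> C"
  shows "summable (\<lambda>t. expectation (\<lambda>\<omega>. (g t \<omega>)\<^sup>2))"
proof (rule bounded_imp_summable)
  show "(\<Sum>t\<le>n. expectation (\<lambda>\<omega>. (g t \<omega>)\<^sup>2)) \<le> C" for n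
  proof -
    have "(\<Sum>t\<le>n. expectation (\<lambda>\<omega>. (g t \<omega>)\<^sup>2)) = expectation (\<lambda>\<omega>. \<Sum>t\<le>n. (g t \<omega>)\<^sup>2)"
      by (simp add: Bochner_Integration.integral_sum integrable_g_square)
    also have "\<dots> \<le> C"
    proof (rule integral_le_const)
      show "AE \<omega> in M. (\<Sum>t\<le>n. (g t \<omega>)\<^sup>2) \<le> C"
        using assms
      proof eventually_elim
        case (elim \<omega>)
        then have "(\<Sum>t\<le>n. (g t \<omega>)\<^sup>2) \<le> (\<Sum>t. (g t \<omega>)\<^sup>2)" by (intro sum_le_suminf) auto
        with elim show ?case by linarith
      qed
    qed (simp add: integrable_g_square)
    finally show ?thesis .
  qed
qed simp

end

text \<open>Kolmogorov's maximal inequality: stopping the transform when it first reaches \<open>\<epsilon>\<close> only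
  replaces \<open>g\<close> by a smaller predictable process.\<close>

lemma transform_maximal:
  assumes g: "\<And>t. g t \<in> borel_measurable (F t)" "\<And>t \<omega>. \<omega> \<in> space M \<Longrightarrow> \<bar>g t \<omega>\<bar> \<le> c"
    and "m \<le> n" "0 < \<epsilon>"
  shows "prob {\<omega>\<in>space M. \<exists>k\<in>{m..n}. \<epsilon> \<le> \<bar>transform g m k \<omega>\<bar>} \<le>
    v * (\<Sum>t\<in>{m..<n}. expectation (\<lambda>\<omega>. (g t \<omega>)\<^sup>2)) / \<epsilon>\<^sup>2"
proof -
  \<comment> \<open>For \<open>j \<le> t\<close> the transform up to \<open>j\<close> is known at
    time \<open>t\<close>, so testing all of \<open>{m..t}\<close> keeps \<open>g'\<close>
    predictable and freezes its transform at the first passage.\<close>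
  define g' where "g' t \<omega> = (if \<forall>j\<in>{m..t}. \<bar>transform g m j \<omega>\<bar> < \<epsilon> then g t \<omega> else 0)" for t \<omega>
  have g'_pred: "g' t \<in> borel_measurable (F t)" for t
  proof -
    have [measurable]: "g t \<in> borel_measurable (F t)" by (rule g)
    have [measurable]: "Measurable.pred (F t) (\<lambda>\<omega>. \<forall>j\<in>{m..t}. \<bar>transform g m j \<omega>\<bar> < \<epsilon>)"
    proof (intro pred_intros_finite)
      fix j assume j: "j \<in> {m..t}"
      have [measurable]: "transform g m j \<in> borel_measurable (F t)"
        by (rule measurable_F_mono[OF _ transform_adapted[OF g]]) (use j in auto)
      show "Measurable.pred (F t) (\<lambda>\<omega>. \<bar>transform g m j \<omega>\<bar> < \<epsilon>)" by measurable
    qed simp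
    show ?thesis unfolding g'_def by measurable
  qed
  have c: "0 \<le> c" using g(2) not_empty by fastforce
  have g'_bd: "\<bar>g' t \<omega>\<bar> \<le> c" if "\<omega> \<in> space M" for t \<omega>
    using g(2)[OF that, of t] c by (simp add: g'_def)
  note [measurable] = transform_measurable[OF g] transform_measurable[OF g'_pred g'_bd]
  have stopped: "\<epsilon> \<le> \<bar>transform g' m n \<omega>\<bar>"
    if "k0 \<in> {m..n}" "\<epsilon> \<le> \<bar>transform g m k0 \<omega>\<bar>" for k0 \<omega>
  proof -
    define k where "k = (LEAST k. m \<le> k \<and> \<epsilon> \<le> \<bar>transform g m k \<omega>\<bar>)"
    have k: "m \<le> k" "\<epsilon> \<le> \<bar>transform g m k \<omega>\<bar>" "k \<le> k0"
      unfolding k_def using LeastI[of "\<lambda>k. m \<le> k \<and> \<epsilon> \<le> \<bar>transform g m k \<omega>\<bar>" k0] that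
      by (auto intro: Least_le)
    have below: "\<bar>transform g m j \<omega>\<bar> < \<epsilon>" if "j \<in> {m..<k}" for j
      using not_less_Least[of j "\<lambda>k. m \<le> k \<and> \<epsilon> \<le> \<bar>transform g m k \<omega>\<bar>"] that
      by (auto simp: k_def)
    have "{m..<n} = {m..<k} \<union> {k..<n}" using k that by auto
    then have "transform g' m n \<omega> = (\<Sum>t\<in>{m..<k}. g' t \<omega> * z t \<omega>) + (\<Sum>t\<in>{k..<n}. g' t \<omega> * z t \<omega>)"
      unfolding transform_def by (simp add: sum.union_disjoint)
    also have "(\<Sum>t\<in>{m..<k}. g' t \<omega> * z t \<omega>) = transform g m k \<omega>"
      unfolding transform_def by (intro sum.cong) (use below in \<open>auto simp: g'_def\<close>)
    also have "(\<Sum>t\<in>{k..<n}. g' t \<omega> * z t \<omega>) = 0"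
      by (intro sum.neutral ballI) (use k in \<open>force simp: g'_def\<close>)
    finally show ?thesis using k by simp
  qed
  note T = transform_second_moment[OF g'_pred g'_bd \<open>m \<le> n\<close>]
  have "prob {\<omega>\<in>space M. \<exists>k\<in>{m..n}. \<epsilon> \<le> \<bar>transform g m k \<omega>\<bar>} \<le>
      prob {\<omega>\<in>space M. \<epsilon> \<le> \<bar>transform g' m n \<omega>\<bar>}"
    using stopped by (intro finite_measure_mono) auto
  also have "\<dots> \<le> expectation (\<lambda>\<omega>. (transform g' m n \<omega>)\<^sup>2) / \<epsilon>\<^sup>2"
    using T \<open>0 < \<epsilon>\<close> by (intro second_moment_method) auto
  also have "\<dots> \<le> v * (\<Sum>t\<in>{m..<n}. expectation (\<lambda>\<omega>. (g' t \<omega>)\<^sup>2)) / \<epsilon>\<^sup>2"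
    using T by (intro divide_right_mono) auto
  also have "\<dots> \<le> v * (\<Sum>t\<in>{m..<n}. expectation (\<lambda>\<omega>. (g t \<omega>)\<^sup>2)) / \<epsilon>\<^sup>2"
    by (intro divide_right_mono mult_left_mono sum_mono integral_mono v_nonneg
        integrable_g_square[OF g'_pred g'_bd] integrable_g_square[OF g]) (auto simp: g'_def)
  finally show ?thesis .
qed

text \<open>The maximal inequality, passed to an infinite horizon, bounds the probability that the
  transform started at \<open>m\<close> ever reaches \<open>\<epsilon>\<close> by a tail of a
  convergent series. Letting \<open>m\<close> grow makes the partial sums almost surely
  Cauchy.\<close>

theorem transform_convergent:
  assumes g: "\<And>t. g t \<in> borel_measurable (F t)" "\<And>t \<omega>. \<omega> \<in> space M \<Longrightarrow> \<bar>g t \<omega>\<bar> \<le> c"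
    and squares: "AE \<omega> in M. summable (\<lambda>t. (g t \<omega>)\<^sup>2) \<and> (\<Sum>t. (g t \<omega>)\<^sup>2) \<le> C"
  shows "AE \<omega> in M. convergent (\<lambda>n. \<Sum>t<n. g t \<omega> * z t \<omega>)"
proof -
  note [measurable] = transform_measurable[OF g]
  define V where "V t = expectation (\<lambda>\<omega>. (g t \<omega>)\<^sup>2)" for t
  have V0: "0 \<le> V t" for t by (simp add: V_def)
  have summ: "summable V" using expectation_g_square_sum[OF g squares] by (simp add: V_def[abs_def])
  have tail: "prob {\<omega>\<in>space M. \<exists>k\<ge>m. \<epsilon> \<le> \<bar>transform g m k \<omega>\<bar>} \<le> v * (\<Sum>t. V (t + m)) / \<epsilon>\<^sup>2"
    if "0 < \<epsilon>" for m \<epsilon>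
  proof (rule LIMSEQ_le_const2)
    have "(\<exists>n. \<exists>k\<in>{m..m + n}. P k) \<longleftrightarrow> (\<exists>k\<ge>m. P k)" for P
      by (meson atLeastAtMost_iff le_add2)
    then have "(\<Union>n. {\<omega>\<in>space M. \<exists>k\<in>{m..m + n}. \<epsilon> \<le> \<bar>transform g m k \<omega>\<bar>}) =
        {\<omega>\<in>space M. \<exists>k\<ge>m. \<epsilon> \<le> \<bar>transform g m k \<omega>\<bar>}"
      by auto
    moreover have "incseq (\<lambda>n. {\<omega>\<in>space M. \<exists>k\<in>{m..m + n}. \<epsilon> \<le> \<bar>transform g m k \<omega>\<bar>})"
      by (force simp: incseq_def)
    ultimately show "(\<lambda>n. prob {\<omega>\<in>space M. \<exists>k\<in>{m..m + n}. \<epsilon> \<le> \<bar>transform g m k \<omega>\<bar>}) \<longlonglongrightarrow>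
        prob {\<omega>\<in>space M. \<exists>k\<ge>m. \<epsilon> \<le> \<bar>transform g m k \<omega>\<bar>}"
      using finite_Lim_measure_incseq[of "\<lambda>n. {\<omega>\<in>space M. \<exists>k\<in>{m..m + n}. \<epsilon> \<le> \<bar>transform g m k \<omega>\<bar>}"]
      by (simp add: image_subset_iff)
    have "prob {\<omega>\<in>space M. \<exists>k\<in>{m..m + n}. \<epsilon> \<le> \<bar>transform g m k \<omega>\<bar>} \<le>
        v * (\<Sum>t. V (t + m)) / \<epsilon>\<^sup>2" for n
    proof -
      have "(\<Sum>t\<in>{m..<m + n}. V t) = (\<Sum>t<n. V (t + m))"
        by (rule sum.reindex_bij_witness[of _ "\<lambda>t. t + m" "\<lambda>t. t - m"]) auto
      also have "\<dots> \<le> (\<Sum>t. V (t + m))"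
        using summ V0 by (intro sum_le_suminf summable_ignore_initial_segment) auto
      finally have *: "v * (\<Sum>t\<in>{m..<m + n}. V t) / \<epsilon>\<^sup>2 \<le> v * (\<Sum>t. V (t + m)) / \<epsilon>\<^sup>2"
        by (intro divide_right_mono mult_left_mono v_nonneg) auto
      show ?thesis
        using transform_maximal[OF g, of m "m + n" \<epsilon>] * \<open>0 < \<epsilon>\<close> by (simp add: V_def)
    qed
    then show "\<exists>N. \<forall>n\<ge>N. prob {\<omega>\<in>space M. \<exists>k\<in>{m..m + n}. \<epsilon> \<le> \<bar>transform g m k \<omega>\<bar>} \<le>
        v * (\<Sum>t. V (t + m)) / \<epsilon>\<^sup>2" by blast
  qed
  have osc: "AE \<omega> in M. \<exists>m. \<forall>k\<ge>m. \<bar>transform g m k \<omega>\<bar> < \<epsilon>" if "0 < \<epsilon>" for \<epsilon>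
  proof -
    let ?B = "{\<omega>\<in>space M. \<forall>m. \<exists>k\<ge>m. \<epsilon> \<le> \<bar>transform g m k \<omega>\<bar>}"
    have B: "?B \<in> sets M" by measurable
    have "(\<lambda>m. v * (\<Sum>t. V (t + m)) / \<epsilon>\<^sup>2) \<longlonglongrightarrow> v * 0 / \<epsilon>\<^sup>2"
      using suminf_exist_split2[OF summ] \<open>0 < \<epsilon>\<close> by (intro tendsto_intros) auto
    moreover have "prob ?B \<le> v * (\<Sum>t. V (t + m)) / \<epsilon>\<^sup>2" for m
    proof -
      have "prob ?B \<le> prob {\<omega>\<in>space M. \<exists>k\<ge>m. \<epsilon> \<le> \<bar>transform g m k \<omega>\<bar>}"
        by (intro finite_measure_mono) auto
      then show ?thesis using tail[OF that, of m] by linarith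
    qed
    ultimately have "prob ?B \<le> 0" by (intro LIMSEQ_le_const) auto
    then have "prob ?B = 0" using measure_nonneg[of M ?B] by linarith
    then have "AE \<omega> in M. \<omega> \<notin> ?B" using B by (simp add: prob_eq_0)
    with AE_space show ?thesis by eventually_elim (force simp: not_le)
  qed
  \<comment> \<open>Countably many tolerances, so that the exceptional null sets can be
    united.\<close>
  have "AE \<omega> in M. \<forall>i. \<exists>m. \<forall>k\<ge>m. \<bar>transform g m k \<omega>\<bar> < inverse (real (Suc i))"
    unfolding AE_all_countable using osc by simp
  then show ?thesis
  proof eventually_elim
    case (elim \<omega>)
    show ?case
    proof (rule Cauchy_convergent, rule metric_CauchyI)
      fix e :: real assume "0 < e"
      then obtain i where i: "inverse (real (Suc i)) < e / 2"
        using reals_Archimedean[of "e / 2"] by auto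
      obtain m where m: "\<And>k. k \<ge> m \<Longrightarrow> \<bar>transform g m k \<omega>\<bar> < inverse (real (Suc i))"
        using elim by blast
      have eq: "(\<Sum>t<k. g t \<omega> * z t \<omega>) = (\<Sum>t<m. g t \<omega> * z t \<omega>) + transform g m k \<omega>" if "k \<ge> m" for k
      proof -
        have "{..<k} = {..<m} \<union> {m..<k}" using that by auto
        then show ?thesis by (simp add: transform_def sum.union_disjoint ivl_disj_int)
      qed
      have "dist (\<Sum>t<k. g t \<omega> * z t \<omega>) (\<Sum>t<l. g t \<omega> * z t \<omega>) < e" if "k \<ge> m" "l \<ge> m" for k l
        using m[OF that(1)] m[OF that(2)] i unfolding eq[OF that(1)] eq[OF that(2)] dist_real_def
        by linarith
      then show "\<exists>N. \<forall>k\<ge>N. \<forall>l\<ge>N. dist (\<Sum>t<k. g t \<omega> * z t \<omega>) (\<Sum>t<l. g t \<omega> * z t \<omega>) < e"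
        by blast
    qed
  qed
qed

end

section \<open>Conditional laws and independence\<close>

text \<open>The conditional probability of \<open>X \<in> B\<close> is almost surely the constant
  \<open>measure \<mu> B\<close>; integrating it over \<open>A\<close> gives the product.\<close>

lemma has_cond_law_prob:
  assumes "prob_space M" and sub: "subalgebra M H" and law: "has_cond_law M H X \<mu>"
    and A: "A \<in> sets H" and B: "B \<in> sets \<mu>"
  shows "measure M (A \<inter> (X -` B \<inter> space M)) = measure M A * measure \<mu> B"
proof -
  interpret prob_space M by fact
  interpret finite_measure_subalgebra M H by unfold_locales (rule sub)
  have AM: "A \<in> sets M" using A sub by (auto simp: subalgebra_def)
  have X: "X \<in> M \<rightarrow>\<^sub>M \<mu>" using law by (simp add: has_cond_law_def)
  have int: "integrable M (\<lambda>\<omega>. indicator B (X \<omega>) :: real)"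
    by (rule integrable_const_bound[where B = 1]) (use X B in \<open>auto simp: indicator_def\<close>)
  have "measure M (A \<inter> (X -` B \<inter> space M)) = (\<integral>\<omega>. indicator (A \<inter> (X -` B \<inter> space M)) \<omega> \<partial>M)"
    using AM X B by (simp add: Int_absorb1 sets.Int measurable_sets)
  also have "\<dots> = (\<integral>\<omega>\<in>A. indicator B (X \<omega>) \<partial>M)"
    unfolding set_lebesgue_integral_def by (intro Bochner_Integration.integral_cong) (auto simp: indicator_def)
  also have "\<dots> = (\<integral>\<omega>\<in>A. real_cond_exp M H (\<lambda>\<omega>. indicator B (X \<omega>)) \<omega> \<partial>M)"
    by (rule real_cond_exp_intA[OF int A])
  also have "\<dots> = (\<integral>\<omega>\<in>A. measure \<mu> B \<partial>M)"
  proof -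
    have "AE \<omega> in M. real_cond_exp M H (\<lambda>\<omega>. indicator B (X \<omega>)) \<omega> = measure \<mu> B"
      using law B by (simp add: has_cond_law_def)
    then show ?thesis
      unfolding set_lebesgue_integral_def using AM by (intro integral_cong_AE) auto
  qed
  also have "\<dots> = measure M A * measure \<mu> B"
    using AM by (simp add: set_lebesgue_integral_def Int_absorb2 sets.sets_into_space)
  finally show ?thesis .
qed

lemma has_cond_law_distr:
  assumes M: "prob_space M" and \<mu>: "prob_space \<mu>" and sub: "subalgebra M H"
    and law: "has_cond_law M H X \<mu>"
  shows "distr M \<mu> X = \<mu>"
proof (rule measure_eqI)
  interpret prob_space M by fact
  interpret \<mu>: prob_space \<mu> by fact
  fix B assume "B \<in> sets (distr M \<mu> X)"
  then have B: "B \<in> sets \<mu>" by simp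
  have X: "X \<in> M \<rightarrow>\<^sub>M \<mu>" using law by (simp add: has_cond_law_def)
  have "space M \<in> sets H" using sub by (metis subalgebra_def sets.top)
  from has_cond_law_prob[OF M sub law this B] have "measure M (X -` B \<inter> space M) = measure \<mu> B"
    by (simp add: prob_space Int_absorb1)
  then show "emeasure (distr M \<mu> X) B = emeasure \<mu> B"
    using X B by (simp add: emeasure_distr emeasure_eq_measure \<mu>.emeasure_eq_measure)
qed simp

lemma Int_stable_preimages: "Int_stable {f -` A \<inter> \<Omega> |A. A \<in> sets L}"
proof (rule Int_stableI)
  fix a b assume "a \<in> {f -` A \<inter> \<Omega> |A. A \<in> sets L}" "b \<in> {f -` A \<inter> \<Omega> |A. A \<in> sets L}"
  then obtain A B where "A \<in> sets L" "B \<in> sets L" "a = f -` A \<inter> \<Omega>" "b = f -` B \<inter> \<Omega>"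
    by blast
  then show "a \<inter> b \<in> {f -` A \<inter> \<Omega> |A. A \<in> sets L}"
    by (intro CollectI exI[of _ "A \<inter> B"]) auto
qed

text \<open>A non-random conditional law amounts to independence of \<open>H\<close>; the product
  formula is checked on preimages, an intersection-stable generator. The map \<open>\<phi>\<close>
  will read off one component of the joint sample.\<close>

lemma has_cond_law_indep_var:
  assumes M: "prob_space M" and \<mu>: "prob_space \<mu>" and sub: "subalgebra M H"
    and law: "has_cond_law M H X \<mu>"
    and \<phi>: "\<phi> \<in> \<mu> \<rightarrow>\<^sub>M T" and Y: "Y \<in> H \<rightarrow>\<^sub>M S"
  shows "prob_space.indep_var M S Y T (\<lambda>\<omega>. \<phi> (X \<omega>))"
proof -
  interpret prob_space M by fact
  have X: "X \<in> M \<rightarrow>\<^sub>M \<mu>" using law by (simp add: has_cond_law_def)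
  have YM: "Y \<in> M \<rightarrow>\<^sub>M S" by (rule measurable_from_subalg[OF sub Y])
  have sp: "space H = space M" using sub by (simp add: subalgebra_def)
  have \<phi>X: "(\<lambda>\<omega>. \<phi> (X \<omega>)) \<in> M \<rightarrow>\<^sub>M T" using X \<phi> by (rule measurable_compose)
  have prod: "prob (Y -` A \<inter> space M \<inter> ((\<lambda>\<omega>. \<phi> (X \<omega>)) -` B \<inter> space M)) =
      prob (Y -` A \<inter> space M) * prob ((\<lambda>\<omega>. \<phi> (X \<omega>)) -` B \<inter> space M)"
    if A: "A \<in> sets S" and B: "B \<in> sets T" for A B
  proof -
    have YA: "Y -` A \<inter> space M \<in> sets H" using measurable_sets[OF Y A] by (simp add: sp)
    have \<phi>B: "\<phi> -` B \<inter> space \<mu> \<in> sets \<mu>" using measurable_sets[OF \<phi> B] .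
    have eq: "(\<lambda>\<omega>. \<phi> (X \<omega>)) -` B \<inter> space M = X -` (\<phi> -` B \<inter> space \<mu>) \<inter> space M"
      using measurable_space[OF X] by auto
    have "prob (X -` (\<phi> -` B \<inter> space \<mu>) \<inter> space M) = measure \<mu> (\<phi> -` B \<inter> space \<mu>)"
      using measure_distr[OF X \<phi>B] has_cond_law_distr[OF M \<mu> sub law] by simp
    with has_cond_law_prob[OF M sub law YA \<phi>B] show ?thesis unfolding eq by simp
  qed
  show ?thesis
    unfolding indep_var_eq
  proof (intro conjI YM \<phi>X indep_set_sigma_sets)
    show "indep_set {Y -` A \<inter> space M |A. A \<in> sets S} {(\<lambda>\<omega>. \<phi> (X \<omega>)) -` A \<inter> space M |A. A \<in> sets T}"
      using measurable_sets[OF YM] measurable_sets[OF \<phi>X] prod by (intro indep_setI) auto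
    show "Int_stable {Y -` A \<inter> space M |A. A \<in> sets S}"
      "Int_stable {(\<lambda>\<omega>. \<phi> (X \<omega>)) -` A \<inter> space M |A. A \<in> sets T}"
      by (rule Int_stable_preimages)+
  qed
qed

section \<open>Policy values and the Bellman equation\<close>

text \<open>\<open>path_pmf\<close> grows at the end of a path, whereas the Bellman recursion
  conditions on the first step.\<close>

lemma path_pmf_Suc_front:
  "path_pmf p \<pi> s (Suc T) = bind_pmf (p s (\<pi> s)) (\<lambda>s'. map_pmf ((#) s) (path_pmf p \<pi> s' T))"
proof (induction T)
  case 0
  show ?case by (simp add: bind_return_pmf map_pmf_def)
next
  case (Suc T)
  \<comment> \<open>Needed for \<open>last (s # xs) = last xs\<close>.\<close>
  have ne: "xs \<noteq> []" if "xs \<in> set_pmf (path_pmf p \<pi> s' T)" for xs s'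
    using that by (cases T) auto
  have "path_pmf p \<pi> s (Suc (Suc T)) =
      bind_pmf (p s (\<pi> s)) (\<lambda>s'. bind_pmf (path_pmf p \<pi> s' T)
        (\<lambda>xs. map_pmf (\<lambda>x. (s # xs) @ [x]) (p (last (s # xs)) (\<pi> (last (s # xs))))))"
    by (subst path_pmf.simps(2)) (simp only: Suc bind_assoc_pmf bind_map_pmf)
  also have "\<dots> = bind_pmf (p s (\<pi> s)) (\<lambda>s'. map_pmf ((#) s) (path_pmf p \<pi> s' (Suc T)))"
    by (intro bind_pmf_cong refl)
      (auto simp: map_bind_pmf pmf.map_comp comp_def ne intro!: bind_pmf_cong)
  finally show ?case .
qed

lemma finite_set_path_pmf:
  fixes p :: "'s::finite \<Rightarrow> 'a \<Rightarrow> 's pmf"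
  shows "finite (set_pmf (path_pmf p \<pi> s T))"
  by (induction T) (auto intro: finite_subset[OF subset_UNIV])

lemma expectation_path_pmf_Suc:
  fixes p :: "'s::finite \<Rightarrow> 'a \<Rightarrow> 's pmf" and h :: "'s list \<Rightarrow> real"
  shows "measure_pmf.expectation (path_pmf p \<pi> s (Suc T)) h =
    (\<Sum>s'\<in>UNIV. pmf (p s (\<pi> s)) s' * measure_pmf.expectation (path_pmf p \<pi> s' T) (\<lambda>xs. h (s # xs)))"
  unfolding path_pmf_Suc_front
  by (subst pmf_expectation_bind[of UNIV]) (auto simp: finite_set_path_pmf)

definition mean_reward :: "('s \<Rightarrow> 'a \<Rightarrow> real measure) \<Rightarrow> 's \<Rightarrow> 'a \<Rightarrow> real" where
  "mean_reward R s a = (\<integral>x. x \<partial>R s a)"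

text \<open>Maps state values to action values. The maximum over \<open>a\<close> gives the
  optimality operator, the choice \<open>a = \<pi> s\<close> the operator of a policy.\<close>

definition q_backup ::
  "('s::finite \<Rightarrow> 'a \<Rightarrow> 's pmf) \<Rightarrow> ('s \<Rightarrow> 'a \<Rightarrow> real measure) \<Rightarrow> real \<Rightarrow> ('s \<Rightarrow> real) \<Rightarrow> 's \<Rightarrow> 'a \<Rightarrow> real"
where
  "q_backup p R \<gamma> f s a = mean_reward R s a + \<gamma> * (\<Sum>s'\<in>UNIV. pmf (p s a) s' * f s')"

lemma opt_q_eq: "opt_q p R \<gamma> = q_backup p R \<gamma> (opt_value p R \<gamma>)"
  by (simp add: fun_eq_iff opt_q_def q_backup_def mean_reward_def)

text \<open>By linearity the rewards enter through their means only: the coordinates of the product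
  measure have the laws prescribed along the path.\<close>

lemma expected_return_mean:
  assumes R: "\<And>s a. finite_variance_law (R s a)"
  shows "expected_return p R \<gamma> \<pi> T s =
    measure_pmf.expectation (path_pmf p \<pi> s T)
      (\<lambda>xs. \<Sum>t\<le>T. \<gamma> ^ t * mean_reward R (xs ! t) (\<pi> (xs ! t)))"
  unfolding expected_return_def
proof (intro arg_cong[where f = "measure_pmf.expectation (path_pmf p \<pi> s T)"] ext)
  fix xs :: "'a list"
  let ?L = "\<lambda>t. R (xs ! t) (\<pi> (xs ! t))"
  have P: "prob_space (?L t)" and S: "sets (?L t) = sets borel" and I: "integrable (?L t) (\<lambda>x. x)" for t
    using R by (auto simp: finite_variance_law_def)
  have D: "distr (PiM {..T} ?L) (?L t) (\<lambda>\<rho>. \<rho> t) = ?L t" if "t \<le> T" for t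
    by (rule distr_PiM_component) (use P that in auto)
  have meas: "(\<lambda>\<rho>. \<rho> t) \<in> PiM {..T} ?L \<rightarrow>\<^sub>M ?L t" if "t \<le> T" for t
    using that by (intro measurable_component_singleton) auto
  have id: "(\<lambda>x. x) \<in> borel_measurable (?L t)" for t
    using S[of t] by (simp add: measurable_ident_sets)
  have int: "integrable (PiM {..T} ?L) (\<lambda>\<rho>. \<rho> t)" if "t \<le> T" for t
    using integrable_distr_eq[OF meas[OF that] id] I[of t] D[OF that] by simp
  have eq: "(\<integral>\<rho>. \<rho> t \<partial>PiM {..T} ?L) = mean_reward R (xs ! t) (\<pi> (xs ! t))" if "t \<le> T" for t
    using integral_distr[OF meas[OF that] id] D[OF that] by (simp add: mean_reward_def)
  show "(\<integral>\<rho>. (\<Sum>t\<le>T. \<gamma> ^ t * \<rho> t) \<partial>PiM {..T} ?L) =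
      (\<Sum>t\<le>T. \<gamma> ^ t * mean_reward R (xs ! t) (\<pi> (xs ! t)))"
    by (subst Bochner_Integration.integral_sum) (auto simp: int eq)
qed

lemma expected_return_Suc:
  fixes p :: "'s::finite \<Rightarrow> 'a \<Rightarrow> 's pmf"
  assumes R: "\<And>s a. finite_variance_law (R s a)"
  shows "expected_return p R \<gamma> \<pi> (Suc T) s = q_backup p R \<gamma> (expected_return p R \<gamma> \<pi> T) s (\<pi> s)"
proof -
  let ?m = "\<lambda>s. mean_reward R s (\<pi> s)"
  have "(\<Sum>t\<le>Suc T. \<gamma> ^ t * ?m ((s # xs) ! t)) = ?m s + \<gamma> * (\<Sum>t\<le>T. \<gamma> ^ t * ?m (xs ! t))" for xs
    by (simp add: sum.atMost_Suc_shift sum_distrib_left mult.assoc del: sum.atMost_Suc)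
  then have "expected_return p R \<gamma> \<pi> (Suc T) s = (\<Sum>s'\<in>UNIV. pmf (p s (\<pi> s)) s' *
      measure_pmf.expectation (path_pmf p \<pi> s' T) (\<lambda>xs. ?m s + \<gamma> * (\<Sum>t\<le>T. \<gamma> ^ t * ?m (xs ! t))))"
    unfolding expected_return_mean[OF R] expectation_path_pmf_Suc by simp
  also have "\<dots> = (\<Sum>s'\<in>UNIV. pmf (p s (\<pi> s)) s' * (?m s + \<gamma> * expected_return p R \<gamma> \<pi> T s'))"
    unfolding expected_return_mean[OF R]
    by (simp add: integrable_measure_pmf_finite finite_set_path_pmf)
  also have "\<dots> = q_backup p R \<gamma> (expected_return p R \<gamma> \<pi> T) s (\<pi> s)"
    by (simp add: q_backup_def distrib_left sum.distrib sum_distrib_left mult_ac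
        flip: sum_distrib_right sum_distrib_left)
      (simp add: sum_pmf_eq_1 flip: sum_distrib_left)
  finally show ?thesis .
qed

text \<open>Horizon \<open>T\<close> collects the rewards at times 0 to \<open>T\<close>, hence
  \<open>Suc T\<close> applications.\<close>

lemma expected_return_iterate:
  fixes p :: "'s::finite \<Rightarrow> 'a \<Rightarrow> 's pmf"
  assumes R: "\<And>s a. finite_variance_law (R s a)"
  shows "expected_return p R \<gamma> \<pi> T = ((\<lambda>f s. q_backup p R \<gamma> f s (\<pi> s)) ^^ Suc T) (\<lambda>_. 0)"
proof (induction T)
  case 0
  show ?case by (simp add: fun_eq_iff expected_return_mean[OF R] q_backup_def)
next
  case (Suc T)
  have "expected_return p R \<gamma> \<pi> (Suc T) = (\<lambda>f s. q_backup p R \<gamma> f s (\<pi> s)) (expected_return p R \<gamma> \<pi> T)"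
    by (simp add: fun_eq_iff expected_return_Suc[OF R])
  then show ?case by (simp only: Suc funpow.simps comp_def)
qed

text \<open>The setting of Banach's theorem for the weighted maximum norm, written with pointwise
  bounds \<open>c * \<xi> s\<close>: where \<open>\<xi>\<close> vanishes, functions at finite
  distance have to coincide. \<open>start\<close> puts the first iterate at finite distance from
  zero.\<close>

locale weighted_contraction =
  fixes \<xi> :: "'s \<Rightarrow> real" and \<beta> c\<^sub>0 :: real and \<Phi> :: "('s \<Rightarrow> real) \<Rightarrow> 's \<Rightarrow> real"
  assumes \<xi>: "\<And>s. 0 \<le> \<xi> s" and \<beta>: "0 \<le> \<beta>" "\<beta> < 1"
    and contraction: "\<And>f g c s. 0 \<le> c \<Longrightarrow> (\<And>s. \<bar>f s - g s\<bar> \<le> c * \<xi> s) \<Longrightarrow> \<bar>\<Phi> f s - \<Phi> g s\<bar> \<le> \<beta> * c * \<xi> s"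
    and start: "0 \<le> c\<^sub>0" "\<And>s. \<bar>\<Phi> (\<lambda>_. 0) s\<bar> \<le> c\<^sub>0 * \<xi> s"
begin

lemma iterate_contraction:
  assumes "0 \<le> c" "\<And>s. \<bar>f s - g s\<bar> \<le> c * \<xi> s"
  shows "\<bar>(\<Phi> ^^ n) f s - (\<Phi> ^^ n) g s\<bar> \<le> \<beta> ^ n * c * \<xi> s"
proof (induction n arbitrary: s)
  case (Suc n)
  then show ?case
    using contraction[of "\<beta> ^ n * c" "(\<Phi> ^^ n) f" "(\<Phi> ^^ n) g" s] assms \<beta> by (simp add: mult.assoc)
qed (use assms in simp)

lemma iterates_tendsto:
  assumes "\<Phi> L = L" "0 \<le> c" "\<And>s. \<bar>f s - L s\<bar> \<le> c * \<xi> s"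
  shows "(\<lambda>n. (\<Phi> ^^ n) f s) \<longlonglongrightarrow> L s"
proof (rule LIM_zero_cancel, rule Lim_null_comparison)
  have "(\<Phi> ^^ n) L = L" for n by (induction n) (auto simp: assms)
  then show "\<forall>\<^sub>F n in sequentially. norm ((\<Phi> ^^ n) f s - L s) \<le> \<beta> ^ n * (c * \<xi> s)"
    using iterate_contraction[of c f L _ s] assms by (intro always_eventually allI) (simp add: mult.assoc)
  show "(\<lambda>n. \<beta> ^ n * (c * \<xi> s)) \<longlonglongrightarrow> 0"
    using \<beta> by (intro tendsto_mult_left_zero LIMSEQ_power_zero) auto
qed

lemma fixpoint:
  obtains L where "\<Phi> L = L" "\<And>s. \<bar>L s\<bar> \<le> c\<^sub>0 / (1 - \<beta>) * \<xi> s"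
proof -
  define C where "C = c\<^sub>0 / (1 - \<beta>)"
  have C: "0 \<le> C" "c\<^sub>0 = C * (1 - \<beta>)" using start(1) \<beta> by (simp_all add: C_def)
  define x where "x n = (\<Phi> ^^ n) (\<lambda>_. 0)" for n
  have x_Suc: "x (Suc n) = \<Phi> (x n)" for n by (simp add: x_def)
  have diff: "\<bar>x (Suc n) s - x n s\<bar> \<le> C * (1 - \<beta>) * \<beta> ^ n * \<xi> s" for n s
  proof -
    have "x (Suc n) = (\<Phi> ^^ n) (\<Phi> (\<lambda>_. 0))" unfolding x_def by (simp only: funpow_Suc_right comp_def)
    then show ?thesis
      using iterate_contraction[of c\<^sub>0 "\<Phi> (\<lambda>_. 0)" "\<lambda>_. 0" n s] start C(2) by (simp add: x_def mult_ac)
  qed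
  \<comment> \<open>Keeping the exact partial sum of the geometric series lets the induction
    close.\<close>
  have dist: "\<bar>x (n + k) s - x n s\<bar> \<le> C * (\<beta> ^ n - \<beta> ^ (n + k)) * \<xi> s" for n k s
  proof (induction k)
    case (Suc k)
    have "\<bar>x (n + Suc k) s - x n s\<bar> \<le> \<bar>x (Suc (n + k)) s - x (n + k) s\<bar> + \<bar>x (n + k) s - x n s\<bar>"
      by simp
    also have "\<dots> \<le> C * (1 - \<beta>) * \<beta> ^ (n + k) * \<xi> s + C * (\<beta> ^ n - \<beta> ^ (n + k)) * \<xi> s"
      using diff[of "n + k" s] Suc by (rule add_mono)
    also have "\<dots> = C * (\<beta> ^ n - \<beta> ^ (n + Suc k)) * \<xi> s" by (simp add: algebra_simps)
    finally show ?case .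
  qed simp
  have dist': "\<bar>x (n + k) s - x n s\<bar> \<le> C * \<xi> s * \<beta> ^ n" for n k s
  proof -
    have "C * (\<beta> ^ n - \<beta> ^ (n + k)) * \<xi> s \<le> C * \<beta> ^ n * \<xi> s"
      using C \<xi>[of s] \<beta> by (intro mult_right_mono mult_left_mono) auto
    with dist[of n k s] show ?thesis by (simp add: mult_ac)
  qed
  have lim0: "(\<lambda>n. C * \<xi> s * \<beta> ^ n) \<longlonglongrightarrow> 0" for s
    using \<beta> by (intro tendsto_mult_right_zero LIMSEQ_power_zero) auto
  have conv: "convergent (\<lambda>n. x n s)" for s
  proof (rule Cauchy_convergent, rule metric_CauchyI)
    fix e :: real assume "0 < e"
    then obtain n where n: "C * \<xi> s * \<beta> ^ n < e / 2"
      using order_tendstoD(2)[OF lim0[of s], of "e / 2"] by (auto simp: eventually_sequentially)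
    have "\<bar>x k s - x n s\<bar> < e / 2" if "k \<ge> n" for k
      using dist'[of n "k - n" s] n that by simp
    then have "dist (x k s) (x l s) < e" if "k \<ge> n" "l \<ge> n" for k l
      using that by (smt (verit) dist_real_def field_sum_of_halves)
    then show "\<exists>M. \<forall>k\<ge>M. \<forall>l\<ge>M. dist (x k s) (x l s) < e" by blast
  qed
  define L where "L s = lim (\<lambda>n. x n s)" for s
  have L: "(\<lambda>n. x n s) \<longlonglongrightarrow> L s" for s
    using conv by (simp add: L_def convergent_LIMSEQ_iff)
  have LB: "\<bar>L s - x n s\<bar> \<le> C * \<beta> ^ n * \<xi> s" for n s
  proof (rule LIMSEQ_le_const2)
    show "(\<lambda>k. \<bar>x (n + k) s - x n s\<bar>) \<longlonglongrightarrow> \<bar>L s - x n s\<bar>"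
      by (subst add.commute) (intro tendsto_intros LIMSEQ_ignore_initial_segment L)
    show "\<exists>N. \<forall>k\<ge>N. \<bar>x (n + k) s - x n s\<bar> \<le> C * \<beta> ^ n * \<xi> s"
      using dist'[of n _ s] by (auto simp: mult_ac)
  qed
  \<comment> \<open>\<open>\<Phi> L\<close> and \<open>L\<close> are both this close to
    \<open>x (Suc n)\<close>, hence the factor 2.\<close>
  have "\<bar>\<Phi> L s - L s\<bar> \<le> 2 * (C * \<xi> s * \<beta> ^ Suc n)" for n s
  proof -
    have "\<bar>\<Phi> L s - x (Suc n) s\<bar> \<le> \<beta> * (C * \<beta> ^ n) * \<xi> s"
      unfolding x_Suc using C \<beta> LB by (intro contraction) auto
    with LB[of s "Suc n"] show ?thesis by (simp add: mult_ac)
  qed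
  moreover have "(\<lambda>n. 2 * (C * \<xi> s * \<beta> ^ Suc n)) \<longlonglongrightarrow> 0" for s
    by (intro tendsto_mult_right_zero LIMSEQ_Suc lim0)
  ultimately have "\<bar>\<Phi> L s - L s\<bar> \<le> 0" for s
    using LIMSEQ_le_const by blast
  then have "\<Phi> L = L" by (auto simp: fun_eq_iff)
  moreover have "\<bar>L s\<bar> \<le> C * \<xi> s" for s using LB[of s 0] by (simp add: x_def)
  ultimately show ?thesis using that by (simp add: C_def)
qed

end

section \<open>Bellman operators and the optimality equation\<close>

lemma Max_image_diff_le:
  fixes u v :: "'a::finite \<Rightarrow> real"
  assumes "\<And>a. \<bar>u a - v a\<bar> \<le> c"
  shows "\<bar>(MAX a. u a) - (MAX a. v a)\<bar> \<le> c"
proof -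
  have "(MAX a. u a) \<le> (MAX a. v a) + c" if "\<And>a. \<bar>u a - v a\<bar> \<le> c" for u v :: "'a \<Rightarrow> real"
  proof (rule Max.boundedI)
    fix x assume "x \<in> range u"
    then obtain a where "x = u a" by blast
    moreover have "v a \<le> (MAX a. v a)" by (rule Max_ge) auto
    ultimately show "x \<le> (MAX a. v a) + c" using that[of a] by linarith
  qed auto
  from this[of u v, OF assms] this[of v u] assms
  have "(MAX a. u a) - (MAX a. v a) \<le> c" "(MAX a. v a) - (MAX a. u a) \<le> c"
    by (simp_all only: abs_minus_commute[of "v _"] diff_le_eq add.commute)
  then show ?thesis by (simp only: abs_le_iff minus_diff_eq)
qed

text \<open>At a state of weight zero, a nonzero mean reward would put already the first iterate at
  infinite weighted distance from zero; \<open>reward_0\<close> excludes this.\<close>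

locale weighted_mdp =
  fixes p :: "'s::finite \<Rightarrow> 'a::finite \<Rightarrow> 's pmf" and R :: "'s \<Rightarrow> 'a \<Rightarrow> real measure"
    and \<gamma> \<beta> :: real and \<xi> :: "'s \<Rightarrow> real"
  assumes R: "\<And>s a. finite_variance_law (R s a)"
    and \<gamma>: "0 \<le> \<gamma>" and \<beta>: "0 \<le> \<beta>" "\<beta> < 1" and \<xi>: "\<And>s. 0 \<le> \<xi> s"
    and weight: "\<And>s a. \<gamma> * (\<Sum>s'\<in>UNIV. pmf (p s a) s' * \<xi> s') \<le> \<beta> * \<xi> s"
    and reward_0: "\<And>s a. \<xi> s = 0 \<Longrightarrow> mean_reward R s a = 0"
begin

lemma q_backup_diff:
  assumes "0 \<le> c" "\<And>s. \<bar>f s - g s\<bar> \<le> c * \<xi> s"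
  shows "\<bar>q_backup p R \<gamma> f s a - q_backup p R \<gamma> g s a\<bar> \<le> \<beta> * c * \<xi> s"
proof -
  have "q_backup p R \<gamma> f s a - q_backup p R \<gamma> g s a = \<gamma> * (\<Sum>s'\<in>UNIV. pmf (p s a) s' * (f s' - g s'))"
    by (simp add: q_backup_def right_diff_distrib sum_subtractf)
  also have "\<bar>\<dots>\<bar> \<le> \<gamma> * (\<Sum>s'\<in>UNIV. pmf (p s a) s' * (c * \<xi> s'))"
    unfolding abs_mult abs_of_nonneg[OF \<gamma>]
    by (intro mult_left_mono \<gamma> order_trans[OF sum_abs] sum_mono)
      (simp add: abs_mult assms mult_left_mono)
  also have "\<dots> = c * (\<gamma> * (\<Sum>s'\<in>UNIV. pmf (p s a) s' * \<xi> s'))"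
    by (simp add: sum_distrib_left mult_ac)
  also have "\<dots> \<le> c * (\<beta> * \<xi> s)" by (intro mult_left_mono weight assms)
  finally show ?thesis by (simp add: mult_ac)
qed

lemma q_backup_mono: "(\<And>s. f s \<le> g s) \<Longrightarrow> q_backup p R \<gamma> f s a \<le> q_backup p R \<gamma> g s a"
  by (auto simp: q_backup_def intro!: mult_left_mono \<gamma> sum_mono)

lemma mean_reward_bound:
  obtains c where "0 \<le> c" "\<And>s a. \<bar>mean_reward R s a\<bar> \<le> c * \<xi> s"
proof -
  \<comment> \<open>Terms with \<open>\<xi> s = 0\<close> count as 0, division by zero being
    0.\<close>
  define c where "c = (\<Sum>s\<in>UNIV. \<Sum>a\<in>UNIV. \<bar>mean_reward R s a\<bar> / \<xi> s)"
  have nn: "0 \<le> \<bar>mean_reward R s a\<bar> / \<xi> s" for s a using \<xi> by simp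
  have "\<bar>mean_reward R s a\<bar> \<le> c * \<xi> s" for s a
  proof (cases "\<xi> s = 0")
    case False
    then have "0 < \<xi> s" using \<xi>[of s] by simp
    have "\<bar>mean_reward R s a\<bar> / \<xi> s \<le> (\<Sum>a\<in>UNIV. \<bar>mean_reward R s a\<bar> / \<xi> s)"
      by (rule member_le_sum[where f = "\<lambda>a. \<bar>mean_reward R s a\<bar> / \<xi> s"]) (auto simp: nn)
    also have "\<dots> \<le> c"
      unfolding c_def
      by (rule member_le_sum[where f = "\<lambda>s. \<Sum>a\<in>UNIV. \<bar>mean_reward R s a\<bar> / \<xi> s"])
        (auto intro!: sum_nonneg nn)
    finally show ?thesis using \<open>0 < \<xi> s\<close> by (simp add: field_simps)
  qed (simp add: reward_0)
  moreover have "0 \<le> c" unfolding c_def by (intro sum_nonneg nn)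
  ultimately show ?thesis using that by blast
qed

text \<open>Let \<open>L\<close> be the fixed point of the optimality operator. A policy operator
  maps \<open>L\<close> below \<open>L\<close>, so by monotonicity its iterates from
  \<open>L\<close> stay below \<open>L\<close>, and they converge to the value of the policy. The
  greedy policy has \<open>L\<close> itself as fixed point, so the supremum is attained.\<close>

lemma
  shows opt_value_eq_Max: "opt_value p R \<gamma> s = (MAX a. opt_q p R \<gamma> s a)"
    and opt_value_bound: "\<exists>c\<ge>0. \<forall>s. \<bar>opt_value p R \<gamma> s\<bar> \<le> c * \<xi> s"
proof -
  obtain c where c: "0 \<le> c" "\<And>s a. \<bar>mean_reward R s a\<bar> \<le> c * \<xi> s" using mean_reward_bound by metis
  have zero: "q_backup p R \<gamma> (\<lambda>_. 0) s a = mean_reward R s a" for s a by (simp add: q_backup_def)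
  let ?\<Phi> = "\<lambda>f s. MAX a. q_backup p R \<gamma> f s a"
  let ?\<Psi> = "\<lambda>\<pi> f s. q_backup p R \<gamma> f s (\<pi> s)"
  interpret opt: weighted_contraction \<xi> \<beta> c ?\<Phi>
  proof
    fix s
    have "\<bar>(MAX a. mean_reward R s a) - (MAX a::'a. 0)\<bar> \<le> c * \<xi> s"
      using c(2) by (intro Max_image_diff_le) simp
    then show "\<bar>MAX a. q_backup p R \<gamma> (\<lambda>_. 0) s a\<bar> \<le> c * \<xi> s" by (simp add: zero)
  qed (auto intro!: Max_image_diff_le q_backup_diff \<xi> \<beta> c)
  have pol: "weighted_contraction \<xi> \<beta> c (?\<Psi> \<pi>)" for \<pi>
    by unfold_locales (auto intro!: q_backup_diff \<xi> \<beta> c simp: zero)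
  obtain L where L: "?\<Phi> L = L" "\<And>s. \<bar>L s\<bar> \<le> c / (1 - \<beta>) * \<xi> s" using opt.fixpoint by metis
  let ?C = "c / (1 - \<beta>)"
  have C: "0 \<le> ?C" using c \<beta> by simp
  \<comment> \<open>The expected returns are iterates from zero; they converge to a fixed point that
    lies at finite weighted distance from zero.\<close>
  have fixed_value: "policy_value p R \<gamma> \<pi> = P" if "?\<Psi> \<pi> P = P" "\<And>s. \<bar>P s\<bar> \<le> ?C * \<xi> s" for \<pi> P
  proof
    fix s
    have "(\<lambda>n. (?\<Psi> \<pi> ^^ n) (\<lambda>_. 0) s) \<longlonglongrightarrow> P s"
      by (rule weighted_contraction.iterates_tendsto[OF pol that(1) C]) (simp only: diff_0 abs_minus_cancel that(2))
    then have "(\<lambda>T. (?\<Psi> \<pi> ^^ Suc T) (\<lambda>_. 0) s) \<longlonglongrightarrow> P s" by (rule LIMSEQ_Suc)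
    then show "policy_value p R \<gamma> \<pi> s = P s"
      unfolding policy_value_def expected_return_iterate[OF R] by (rule limI)
  qed
  have upper: "policy_value p R \<gamma> \<pi> s \<le> L s" for \<pi> s
  proof -
    obtain P where P: "?\<Psi> \<pi> P = P" "\<And>s. \<bar>P s\<bar> \<le> ?C * \<xi> s"
      using weighted_contraction.fixpoint[OF pol] by metis
    have iter: "(?\<Psi> \<pi> ^^ n) L s \<le> L s" for n s
    proof (induction n arbitrary: s)
      case (Suc n)
      have "(?\<Psi> \<pi> ^^ Suc n) L s \<le> ?\<Psi> \<pi> L s"
        by (simp add: Suc q_backup_mono)
      also have "\<dots> \<le> ?\<Phi> L s" by (rule Max_ge) auto
      finally show ?case using L(1) by (metis (no_types, lifting))
    qed simp
    have "(\<lambda>n. (?\<Psi> \<pi> ^^ n) L s) \<longlonglongrightarrow> P s"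
    proof (rule weighted_contraction.iterates_tendsto[OF pol P(1)])
      show "\<bar>L s - P s\<bar> \<le> (2 * ?C) * \<xi> s" for s using L(2)[of s] P(2)[of s] by simp
    qed (use C in simp)
    then have "P s \<le> L s" using iter by (intro LIMSEQ_le_const2) auto
    then show ?thesis using fixed_value[OF P] by simp
  qed
  have "\<exists>a. q_backup p R \<gamma> L s a = (MAX a. q_backup p R \<gamma> L s a)" for s
    using Max_in[of "range (q_backup p R \<gamma> L s)"] by (metis (mono_tags, lifting) finite_imageI finite UNIV_not_empty image_is_empty rangeE)
  then obtain \<pi> where \<pi>: "\<And>s. q_backup p R \<gamma> L s (\<pi> s) = (MAX a. q_backup p R \<gamma> L s a)" by metis
  have greedy: "policy_value p R \<gamma> \<pi> = L"
  proof (rule fixed_value)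
    show "?\<Psi> \<pi> L = L" using L(1) by (simp add: \<pi>)
  qed (rule L)
  have V: "opt_value p R \<gamma> = L"
  proof
    fix s
    have "L s \<in> range (\<lambda>\<pi>. policy_value p R \<gamma> \<pi> s)"
      by (rule image_eqI[where x = \<pi>]) (simp_all add: greedy)
    then show "opt_value p R \<gamma> s = L s"
      unfolding opt_value_def using upper by (intro cSup_eq_maximum) auto
  qed
  show "opt_value p R \<gamma> s = (MAX a. opt_q p R \<gamma> s a)"
    unfolding opt_q_eq V using L(1) by (metis (no_types, lifting))
  show "\<exists>c\<ge>0. \<forall>s. \<bar>opt_value p R \<gamma> s\<bar> \<le> c * \<xi> s" unfolding V using L(2) C by blast
qed

end

lemma weighted_mdp_discounted:
  fixes p :: "'s::finite \<Rightarrow> 'a::finite \<Rightarrow> 's pmf"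
  assumes "\<And>s a. finite_variance_law (R s a)" "0 \<le> \<gamma>" "\<gamma> < 1"
  shows "weighted_mdp p R \<gamma> \<gamma> (\<lambda>_. 1)"
  by unfold_locales (use assms in \<open>simp_all add: sum_pmf_eq_1\<close>)

section \<open>Weights from proper policies\<close>

text \<open>\<open>attractor p s\<^sub>1 n\<close> is the set of states from which every policy reaches \<open>s\<^sub>1\<close> within \<open>n\<close> steps
  with positive probability.\<close>

primrec attractor :: "('s \<Rightarrow> 'a \<Rightarrow> 's pmf) \<Rightarrow> 's \<Rightarrow> nat \<Rightarrow> 's set" where
  "attractor p s\<^sub>1 0 = {s\<^sub>1}"
| "attractor p s\<^sub>1 (Suc n) =
    attractor p s\<^sub>1 n \<union> {s. \<forall>a. \<exists>s'\<in>attractor p s\<^sub>1 n. 0 < pmf (p s a) s'}"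

lemma attractor_mono: "m \<le> n \<Longrightarrow> attractor p s\<^sub>1 m \<subseteq> attractor p s\<^sub>1 n"
  by (induction n rule: dec_induct) auto

text \<open>Suppose that at a state outside the attractor each action had a possible successor
  inside. As there are finitely many actions, one level would contain a successor for each of them,
  and the state would belong to the next level. So some action stays outside almost surely, and
  choosing such actions gives a policy that never visits \<open>s\<^sub>1\<close> from
  outside.\<close>

lemma attractor_exhaustive:
  fixes p :: "'s::finite \<Rightarrow> 'a::finite \<Rightarrow> 's pmf"
  assumes proper: "\<And>\<pi>. proper_policy p s\<^sub>1 \<pi>"
  shows "\<exists>n. s \<in> attractor p s\<^sub>1 n"
proof (rule ccontr)
  define B where "B = (\<Union>n. attractor p s\<^sub>1 n)"
  assume "\<nexists>n. s \<in> attractor p s\<^sub>1 n"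
  then have s: "s \<notin> B" by (simp add: B_def)
  have s1: "s\<^sub>1 \<in> B" unfolding B_def by (rule UN_I[of 0]) auto
  have "\<exists>a. \<forall>s'\<in>B. pmf (p s a) s' = 0" if "s \<notin> B" for s
  proof (rule ccontr)
    assume "\<not> ?thesis"
    then have "\<forall>a. \<exists>n. \<exists>s'\<in>attractor p s\<^sub>1 n. 0 < pmf (p s a) s'"
      unfolding B_def by (metis UN_E pmf_pos)
    then obtain n where n: "\<And>a. \<exists>s'\<in>attractor p s\<^sub>1 (n a). 0 < pmf (p s a) s'" by metis
    have "attractor p s\<^sub>1 (n a) \<subseteq> attractor p s\<^sub>1 (Max (range n))" for a
      by (intro attractor_mono Max_ge) auto
    with n have "s \<in> attractor p s\<^sub>1 (Suc (Max (range n)))" by fastforce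
    then show False using that unfolding B_def by blast
  qed
  then obtain \<pi> where \<pi>: "\<And>s s'. s \<notin> B \<Longrightarrow> s' \<in> B \<Longrightarrow> pmf (p s (\<pi> s)) s' = 0" by metis
  have inv: "length xs = Suc T \<and> set xs \<inter> B = {}" if "xs \<in> set_pmf (path_pmf p \<pi> s T)" for xs T
    using that
  proof (induction T arbitrary: xs)
    case (Suc T)
    then obtain ys x where ys: "ys \<in> set_pmf (path_pmf p \<pi> s T)" "xs = ys @ [x]"
      and x: "x \<in> set_pmf (p (last ys) (\<pi> (last ys)))" by auto
    have IH: "length ys = Suc T" "set ys \<inter> B = {}" using Suc.IH[OF ys(1)] by auto
    then have "last ys \<in> set ys" by (intro last_in_set) auto
    with IH x have "x \<notin> B" using \<pi> by (auto simp: set_pmf_iff)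
    then show ?case using ys IH by simp
  qed (use s in simp)
  have "measure_pmf.prob (path_pmf p \<pi> s t) {xs. xs ! t = s\<^sub>1} = 0" for t
  proof -
    have "set_pmf (path_pmf p \<pi> s t) \<inter> {xs. xs ! t = s\<^sub>1} = {}"
      using inv[of _ t] s1 by (force simp: in_set_conv_nth)
    then show ?thesis by (simp add: measure_pmf_zero_iff)
  qed
  moreover have "(\<lambda>t. measure_pmf.prob (path_pmf p \<pi> s t) {xs. xs ! t = s\<^sub>1}) \<longlonglongrightarrow> 1"
    using proper[of \<pi>] by (simp add: proper_policy_def)
  ultimately have "(0::real) = 1" by (simp only: LIMSEQ_const_iff)
  then show False by simp
qed

text \<open>Under each action, a state of rank \<open>m + 1\<close> has a successor of rank at most
  \<open>m\<close>, with probability at least \<open>2 * \<epsilon>\<close>. So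
  \<open>\<epsilon> ^ d\<close> at least doubles in expectation, and \<open>\<xi>\<close> drops by
  at least \<open>\<epsilon> ^ d s\<close>. As \<open>\<xi> \<le> 1\<close>, this additive drop is
  at least the fixed proportion \<open>1 - \<beta>\<close> of \<open>\<xi> s\<close>.\<close>

lemma proper_imp_weight:
  fixes p :: "'s::finite \<Rightarrow> 'a::finite \<Rightarrow> 's pmf"
  assumes proper: "\<And>\<pi>. proper_policy p s\<^sub>1 \<pi>" and absorbing: "\<And>a. pmf (p s\<^sub>1 a) s\<^sub>1 = 1"
  obtains \<beta> :: real and \<xi> :: "'s \<Rightarrow> real" where "0 \<le> \<beta>" "\<beta> < 1" "\<And>s. 0 \<le> \<xi> s" "\<And>s. \<xi> s = 0 \<longleftrightarrow> s = s\<^sub>1"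
    "\<And>s a. (\<Sum>s'\<in>UNIV. pmf (p s a) s' * \<xi> s') \<le> \<beta> * \<xi> s"
proof -
  define d where "d s = (LEAST n. s \<in> attractor p s\<^sub>1 n)" for s
  have d_in: "s \<in> attractor p s\<^sub>1 (d s)" for s
    unfolding d_def using attractor_exhaustive[OF proper, of s] by (rule LeastI_ex)
  have d_le: "d s \<le> n" if "s \<in> attractor p s\<^sub>1 n" for s n
    unfolding d_def using that by (rule Least_le)
  have d0: "d s = 0 \<longleftrightarrow> s = s\<^sub>1" for s
    using d_in[of s] d_le[of s 0] by auto
  define E where "E = insert 1 {x. 0 < x \<and> (\<exists>s a s'. x = pmf (p s a) s')}"
  have "finite {x. \<exists>s a s'. x = pmf (p s a) s'}"
    by (rule finite_subset[of _ "\<Union>s. \<Union>a. range (pmf (p s a))"]) auto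
  then have "finite E" unfolding E_def by (auto elim: finite_subset[rotated])
  \<comment> \<open>Halving provides the factor 2 in the doubling, and
    \<open>\<epsilon> < 1\<close>, so that the weight vanishes at \<open>s\<^sub>1\<close>
    only.\<close>
  define \<epsilon> where "\<epsilon> = Min E / 2"
  have E: "0 < Min E" "Min E \<le> 1" using \<open>finite E\<close> by (auto simp: E_def)
  then have \<epsilon>: "0 < \<epsilon>" "\<epsilon> \<le> 1" by (simp_all add: \<epsilon>_def)
  have \<epsilon>_le: "2 * \<epsilon> \<le> pmf (p s a) s'" if "0 < pmf (p s a) s'" for s a s'
    using \<open>finite E\<close> that by (auto simp: \<epsilon>_def E_def intro!: Min_le)
  define \<xi> where "\<xi> s = 1 - \<epsilon> ^ d s" for s
  define \<beta> where "\<beta> = 1 - \<epsilon> ^ Max (range d)"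
  have pw: "0 < \<epsilon> ^ n" "\<epsilon> ^ n \<le> 1" for n using \<epsilon> by (auto intro: power_le_one)
  have \<xi>0: "\<xi> s = 0 \<longleftrightarrow> s = s\<^sub>1" for s
  proof
    assume "\<xi> s = 0"
    moreover have "\<epsilon> < 1" using E by (simp add: \<epsilon>_def)
    ultimately have "d s = 0"
      using power_Suc_less_one[of \<epsilon> "d s - 1"] \<epsilon> by (cases "d s") (auto simp: \<xi>_def)
    then show "s = s\<^sub>1" by (simp add: d0)
  qed (use d0[of s\<^sub>1] in \<open>simp add: \<xi>_def\<close>)
  have "(\<Sum>s'\<in>UNIV. pmf (p s a) s' * \<xi> s') \<le> \<beta> * \<xi> s" for s a
  proof (cases "s = s\<^sub>1")
    case True
    have "pmf (p s\<^sub>1 a) s' = 0" if "s' \<noteq> s\<^sub>1" for s'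
    proof -
      have "(\<Sum>s'\<in>UNIV. pmf (p s\<^sub>1 a) s') = 1" by (simp add: sum_pmf_eq_1)
      then have "(\<Sum>s'\<in>UNIV - {s\<^sub>1}. pmf (p s\<^sub>1 a) s') = 0"
        by (simp add: sum.remove[of UNIV s\<^sub>1] absorbing)
      then show ?thesis using that by (simp add: sum_nonneg_eq_0_iff)
    qed
    then have "pmf (p s\<^sub>1 a) s' * \<xi> s' = 0" for s' using \<xi>0[of s'] by (cases "s' = s\<^sub>1") auto
    then have "(\<Sum>s'\<in>UNIV. pmf (p s\<^sub>1 a) s' * \<xi> s') = 0" by (intro sum.neutral) blast
    then show ?thesis using \<xi>0[of s] by (simp add: True)
  next
    case False
    then obtain m where m: "d s = Suc m" using d0[of s] by (cases "d s") auto
    then have "s \<notin> attractor p s\<^sub>1 m" using d_le[of s m] by auto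
    with d_in[of s] m obtain s' where s': "s' \<in> attractor p s\<^sub>1 m" "0 < pmf (p s a) s'" by auto
    have "2 * \<epsilon> ^ d s = (2 * \<epsilon>) * \<epsilon> ^ m" by (simp add: m)
    also have "\<dots> \<le> pmf (p s a) s' * \<epsilon> ^ d s'"
      using \<epsilon>_le[OF s'(2)] d_le[OF s'(1)] \<epsilon> pw by (intro mult_mono power_decreasing) auto
    also have "\<dots> \<le> (\<Sum>s'\<in>UNIV. pmf (p s a) s' * \<epsilon> ^ d s')"
      using \<epsilon> by (intro member_le_sum[where f = "\<lambda>s'. pmf (p s a) s' * \<epsilon> ^ d s'"]) auto
    finally have "2 * \<epsilon> ^ d s \<le> (\<Sum>s'\<in>UNIV. pmf (p s a) s' * \<epsilon> ^ d s')" .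
    moreover have "(\<Sum>s'\<in>UNIV. pmf (p s a) s' * \<xi> s') = 1 - (\<Sum>s'\<in>UNIV. pmf (p s a) s' * \<epsilon> ^ d s')"
      by (simp add: \<xi>_def right_diff_distrib sum_subtractf sum_pmf_eq_1)
    moreover have "\<epsilon> ^ Max (range d) \<le> \<epsilon> ^ d s"
      using \<epsilon> by (intro power_decreasing Max_ge) auto
    moreover have "0 \<le> \<epsilon> ^ Max (range d) * \<epsilon> ^ d s" using pw by (simp add: less_imp_le)
    ultimately show ?thesis by (simp add: \<xi>_def \<beta>_def algebra_simps)
  qed
  moreover have "0 \<le> \<beta>" "\<beta> < 1" "\<And>s. 0 \<le> \<xi> s" using pw by (auto simp: \<beta>_def \<xi>_def)
  ultimately show ?thesis using that \<xi>0 by blast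
qed

section \<open>Convergence of the iteration\<close>

lemma distr_pair_snd:
  assumes "prob_space A" "prob_space B"
  shows "distr (A \<Otimes>\<^sub>M B) B snd = B"
proof -
  interpret A: prob_space A by fact
  interpret B: prob_space B by fact
  show ?thesis
  proof (rule measure_eqI)
    fix X assume "X \<in> sets (distr (A \<Otimes>\<^sub>M B) B snd)"
    then have X: "X \<in> sets B" by simp
    have "snd -` X \<inter> space (A \<Otimes>\<^sub>M B) = space A \<times> X"
      using sets.sets_into_space[OF X] by (auto simp: space_pair_measure)
    then show "emeasure (distr (A \<Otimes>\<^sub>M B) B snd) X = emeasure B X"
      using X by (simp add: emeasure_distr B.emeasure_pair_measure_Times A.emeasure_space_1)
  qed simp
qed

text \<open>Serves both cases. \<open>initial_0\<close> and \<open>reward_AE_0\<close> speak of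
  states of weight zero: there are none in case (i), and only \<open>s\<^sub>1\<close> in case (ii).
  A zero mean reward would not do there: the samples themselves have to vanish for the estimates to
  stay at zero.\<close>

locale generalized_q_learning = weighted_mdp p R \<gamma> \<beta> \<xi> + prob_space M
  for p :: "'s::finite \<Rightarrow> 'a::finite \<Rightarrow> 's pmf" and R :: "'s \<Rightarrow> 'a \<Rightarrow> real measure"
    and \<gamma> \<beta> :: real and \<xi> :: "'s \<Rightarrow> real" and M :: "'w measure" +
  fixes C :: real and N K :: nat
    and G :: "('a \<Rightarrow> nat \<Rightarrow> nat \<Rightarrow> real) \<Rightarrow> real"
    and F :: "nat \<Rightarrow> 'w measure"
    and \<alpha> :: "nat \<Rightarrow> nat \<Rightarrow> 's \<Rightarrow> 'a \<Rightarrow> 'w \<Rightarrow> real"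
    and r :: "nat \<Rightarrow> 's \<Rightarrow> 'a \<Rightarrow> 'w \<Rightarrow> real"
    and f :: "nat \<Rightarrow> 's \<Rightarrow> 'a \<Rightarrow> 'w \<Rightarrow> 's"
    and Q :: "int \<Rightarrow> nat \<Rightarrow> 's \<Rightarrow> 'a \<Rightarrow> 'w \<Rightarrow> real"
  assumes N: "N \<ge> 1" and K: "K \<ge> 1"
    and G1: "G_consistent N K G"
    and G2: "G_nonexpansive N K G"
    and history: "filtration (space M) F" "\<And>t. subalgebra M (F t)"
    and samples_adapted:
      "\<And>t s a. r t s a \<in> F (Suc t) \<rightarrow>\<^sub>M borel"
      "\<And>t s a. f t s a \<in> F (Suc t) \<rightarrow>\<^sub>M count_space UNIV"
    and samples_law:
      "\<And>t. has_cond_law M (F t)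
              (\<lambda>\<omega>. \<lambda>(s, a). (r t s a \<omega>, f t s a \<omega>))
              (\<Pi>\<^sub>M (s, a)\<in>UNIV. R s a \<Otimes>\<^sub>M measure_pmf (p s a))"
    and step_measurable:
      "\<And>t i s a. i \<in> {1..N} \<Longrightarrow> \<alpha> t i s a \<in> F t \<rightarrow>\<^sub>M borel"
    and step_range:
      "\<And>t i s a \<omega>. i \<in> {1..N} \<Longrightarrow> \<omega> \<in> space M \<Longrightarrow> 0 \<le> \<alpha> t i s a \<omega> \<and> \<alpha> t i s a \<omega> \<le> 1"
    and step_squares:
      "\<And>i s a. i \<in> {1..N} \<Longrightarrow>
         AE \<omega> in M. summable (\<lambda>t. (\<alpha> t i s a \<omega>)\<^sup>2) \<and> (\<Sum>t. (\<alpha> t i s a \<omega>)\<^sup>2) \<le> C"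
    and step_diverges:
      "\<And>i s a. i \<in> {1..N} \<Longrightarrow>
         AE \<omega> in M. filterlim (\<lambda>n. \<Sum>t<n. \<alpha> t i s a \<omega>) at_top sequentially"
    and initial_measurable:
      "\<And>\<tau> i s a. \<tau> \<in> {- int K + 1..0} \<Longrightarrow> i \<in> {1..N} \<Longrightarrow> Q \<tau> i s a \<in> F 0 \<rightarrow>\<^sub>M borel"
    and iteration:
      "\<And>t i s a \<omega>. i \<in> {1..N} \<Longrightarrow> \<omega> \<in> space M \<Longrightarrow>
         Q (int t + 1) i s a \<omega> =
           Q (int t) i s a \<omega> +
           \<alpha> t i s a \<omega> *
             (r t s a \<omega> + \<gamma> * G (\<lambda>b k j. Q (int t - int j) k (f t s a \<omega>) b \<omega>)
              - Q (int t) i s a \<omega>)"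
    and initial_0:
      "\<And>\<tau> i s a \<omega>. \<xi> s = 0 \<Longrightarrow> \<tau> \<in> {- int K + 1..0} \<Longrightarrow> i \<in> {1..N} \<Longrightarrow> \<omega> \<in> space M \<Longrightarrow> Q \<tau> i s a \<omega> = 0"
    and reward_AE_0: "\<And>s a. \<xi> s = 0 \<Longrightarrow> AE x in R s a. x = 0"
begin

section \<open>Laws and independence of the samples\<close>

abbreviation sample_law :: "('s \<times> 'a \<Rightarrow> real \<times> 's) measure" where
  "sample_law \<equiv> \<Pi>\<^sub>M (s, a)\<in>UNIV. R s a \<Otimes>\<^sub>M measure_pmf (p s a)"

abbreviation sample :: "nat \<Rightarrow> 'w \<Rightarrow> 's \<times> 'a \<Rightarrow> real \<times> 's" where
  "sample t \<omega> \<equiv> \<lambda>(s, a). (r t s a \<omega>, f t s a \<omega>)"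

lemma R_prob: "prob_space (R s a)" and R_sets: "sets (R s a) = sets borel"
  and R_integrable: "integrable (R s a) (\<lambda>x. x)"
  and R_square: "integrable (R s a) (\<lambda>x. (x - mean_reward R s a)\<^sup>2)"
  using R by (auto simp: finite_variance_law_def mean_reward_def)

lemma step_law_prob: "prob_space (R s a \<Otimes>\<^sub>M measure_pmf (p s a))"
  by (intro prob_space_pair R_prob measure_pmf.prob_space_axioms)

lemma sample_law_prob: "prob_space sample_law"
  by (intro prob_space_PiM) (auto simp: step_law_prob split: prod.split)

lemma sample_measurable: "sample t \<in> M \<rightarrow>\<^sub>M sample_law"
  using samples_law[of t] by (simp add: has_cond_law_def)

lemma component_measurable:
  "(\<lambda>x. x (s, a)) \<in> sample_law \<rightarrow>\<^sub>M R s a \<Otimes>\<^sub>M measure_pmf (p s a)"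
  using measurable_component_singleton[of "(s, a)" UNIV "\<lambda>(s, a). R s a \<Otimes>\<^sub>M measure_pmf (p s a)"]
  by simp

lemma distr_component:
  "distr M (R s a \<Otimes>\<^sub>M measure_pmf (p s a)) (\<lambda>\<omega>. (r t s a \<omega>, f t s a \<omega>)) =
    R s a \<Otimes>\<^sub>M measure_pmf (p s a)"
proof -
  have "distr sample_law (R s a \<Otimes>\<^sub>M measure_pmf (p s a)) (\<lambda>x. x (s, a)) = R s a \<Otimes>\<^sub>M measure_pmf (p s a)"
    using distr_PiM_component[of UNIV "\<lambda>(s, a). R s a \<Otimes>\<^sub>M measure_pmf (p s a)" "(s, a)"]
    by (auto simp: step_law_prob split: prod.split)
  then have "distr (distr M sample_law (sample t)) (R s a \<Otimes>\<^sub>M measure_pmf (p s a)) (\<lambda>x. x (s, a)) =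
      R s a \<Otimes>\<^sub>M measure_pmf (p s a)"
    by (simp add: has_cond_law_distr[OF prob_space_axioms sample_law_prob history(2) samples_law])
  then show ?thesis
    by (simp add: distr_distr[OF component_measurable sample_measurable] comp_def)
qed

lemma r_f_measurable:
  "(\<lambda>\<omega>. (r t s a \<omega>, f t s a \<omega>)) \<in> M \<rightarrow>\<^sub>M R s a \<Otimes>\<^sub>M measure_pmf (p s a)"
  using measurable_compose[OF sample_measurable component_measurable] by simp

lemma distr_r: "distr M (R s a) (r t s a) = R s a"
proof -
  have "distr (distr M (R s a \<Otimes>\<^sub>M measure_pmf (p s a)) (\<lambda>\<omega>. (r t s a \<omega>, f t s a \<omega>))) (R s a) fst = R s a"
    by (simp only: distr_component prob_space.distr_pair_fst[OF measure_pmf.prob_space_axioms])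
  then show ?thesis
    by (simp add: distr_distr[OF measurable_fst r_f_measurable] comp_def)
qed

lemma distr_f: "distr M (measure_pmf (p s a)) (f t s a) = measure_pmf (p s a)"
proof -
  have "distr (distr M (R s a \<Otimes>\<^sub>M measure_pmf (p s a)) (\<lambda>\<omega>. (r t s a \<omega>, f t s a \<omega>))) (measure_pmf (p s a)) snd =
      measure_pmf (p s a)"
    by (simp only: distr_component distr_pair_snd R_prob measure_pmf.prob_space_axioms)
  then show ?thesis
    by (simp add: distr_distr[OF measurable_snd r_f_measurable] comp_def)
qed

lemma r_measurable: "r t s a \<in> M \<rightarrow>\<^sub>M R s a"
  using measurable_compose[OF r_f_measurable measurable_fst] by simp

lemma f_measurable: "f t s a \<in> M \<rightarrow>\<^sub>M measure_pmf (p s a)"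
  using measurable_compose[OF r_f_measurable measurable_snd] by simp

lemma sample_indep_var:
  assumes "\<phi> \<in> borel_measurable (R s a \<Otimes>\<^sub>M measure_pmf (p s a))" "Y \<in> borel_measurable (F t)"
  shows "indep_var borel Y borel (\<lambda>\<omega>. \<phi> (r t s a \<omega>, f t s a \<omega>))"
  using has_cond_law_indep_var[OF prob_space_axioms sample_law_prob history(2) samples_law
      measurable_compose[OF component_measurable assms(1)] assms(2)] by simp

lemma F_mono: "s \<le> t \<Longrightarrow> sets (F s) \<subseteq> sets (F t)"
  using filtration.sets_F_mono[OF history(1)] .

lemma reward_innovations:
  "independent_innovations M F (\<lambda>t \<omega>. r t s a \<omega> - mean_reward R s a)
    (\<integral>x. (x - mean_reward R s a)\<^sup>2 \<partial>R s a)"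
proof
  have id: "(\<lambda>x. x) \<in> borel_measurable (R s a)"
    using R_sets by (simp add: measurable_ident_sets)
  have sq: "(\<lambda>x. (x - mean_reward R s a)\<^sup>2) \<in> borel_measurable (R s a)"
    using id by measurable
  interpret R: prob_space "R s a" by (rule R_prob)
  fix t
  show "integrable M (\<lambda>\<omega>. (r t s a \<omega> - mean_reward R s a)\<^sup>2)"
    using integrable_distr_eq[OF r_measurable sq] R_square by (simp add: distr_r)
  show "expectation (\<lambda>\<omega>. (r t s a \<omega> - mean_reward R s a)\<^sup>2) \<le> (\<integral>x. (x - mean_reward R s a)\<^sup>2 \<partial>R s a)"
    using integral_distr[OF r_measurable sq, of t] by (simp add: distr_r)
  have c: "(\<lambda>x. x - mean_reward R s a) \<in> borel_measurable (R s a)" using id by measurable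
  have "(\<integral>x. x - mean_reward R s a \<partial>R s a) = 0"
    using R_integrable by (simp add: R.prob_space mean_reward_def)
  then show "expectation (\<lambda>\<omega>. r t s a \<omega> - mean_reward R s a) = 0"
    using integral_distr[OF r_measurable c, of t] by (simp add: distr_r)
  show "(\<lambda>\<omega>. r t s a \<omega> - mean_reward R s a) \<in> borel_measurable (F (Suc t))"
    using samples_adapted(1)[of t s a] by measurable
  fix Y :: "'w \<Rightarrow> real" assume "Y \<in> borel_measurable (F t)"
  then show "indep_var borel Y borel (\<lambda>\<omega>. r t s a \<omega> - mean_reward R s a)"
    using sample_indep_var[OF measurable_compose[OF measurable_fst c]] by simp
qed (use history F_mono in auto)

text \<open>One centred indicator for each possible successor \<open>s'\<close>; the noise of a
  transition combines these with coefficients known at time \<open>t\<close>.\<close>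

lemma transition_innovations:
  "independent_innovations M F (\<lambda>t \<omega>. of_bool (f t s a \<omega> = s') - pmf (p s a) s') 1"
proof
  fix t
  have bd: "\<bar>of_bool (f t s a \<omega> = s') - pmf (p s a) s'\<bar> \<le> 1" for \<omega>
    using pmf_le_1[of "p s a" s'] pmf_nonneg[of "p s a" s'] by (auto simp: of_bool_def)
  have meas: "(\<lambda>x. h (of_bool (x = s') - pmf (p s a) s') :: real) \<in> borel_measurable (measure_pmf (p s a))" for h
    by simp
  note fm = measurable_compose[OF f_measurable meas]
  have sq: "(of_bool (f t s a \<omega> = s') - pmf (p s a) s')\<^sup>2 \<le> 1" for \<omega>
    using bd[of \<omega>] by (simp add: abs_square_le_1)
  show int: "integrable M (\<lambda>\<omega>. (of_bool (f t s a \<omega> = s') - pmf (p s a) s')\<^sup>2)"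
    by (rule integrable_const_bound[where B = 1]) (use sq fm[of "\<lambda>x. x\<^sup>2"] in auto)
  show "expectation (\<lambda>\<omega>. (of_bool (f t s a \<omega> = s') - pmf (p s a) s')\<^sup>2) \<le> 1"
    by (rule integral_le_const[OF int]) (use sq in simp)
  have "(\<integral>x. of_bool (x = s') - pmf (p s a) s' \<partial>measure_pmf (p s a)) = 0"
    by (subst integral_measure_pmf_real[of UNIV])
      (simp_all add: left_diff_distrib sum_subtractf sum_pmf_eq_1 flip: sum_distrib_left)
  then show "expectation (\<lambda>\<omega>. of_bool (f t s a \<omega> = s') - pmf (p s a) s') = 0"
    using integral_distr[OF f_measurable meas[of "\<lambda>x. x"], of t] by (simp add: distr_f)
  have "(\<lambda>x. of_bool (x = s') - pmf (p s a) s' :: real) \<in> borel_measurable (count_space UNIV)" by simp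
  from measurable_compose[OF samples_adapted(2) this]
  show "(\<lambda>\<omega>. of_bool (f t s a \<omega> = s') - pmf (p s a) s') \<in> borel_measurable (F (Suc t))" .
  fix Y :: "'w \<Rightarrow> real" assume "Y \<in> borel_measurable (F t)"
  then show "indep_var borel Y borel (\<lambda>\<omega>. of_bool (f t s a \<omega> = s') - pmf (p s a) s')"
    using sample_indep_var[OF measurable_compose[OF measurable_snd meas[of "\<lambda>x. x"]]] by simp
qed (use history F_mono in auto)

section \<open>The map \<open>G\<close>, adaptedness of the iterates, and states of weight
  zero\<close>

lemma G_diff_le:
  assumes "\<And>b k j. k \<in> {1..N} \<Longrightarrow> j < K \<Longrightarrow> \<bar>X b k j - Y b k j\<bar> \<le> c"
  shows "\<bar>G X - G Y\<bar> \<le> c"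
proof -
  have "\<bar>G X - G Y\<bar> \<le> (MAX (a, i, j)\<in>UNIV \<times> {1..N} \<times> {..<K}. \<bar>X a i j - Y a i j\<bar>)"
    using G2 unfolding G_nonexpansive_def by blast
  also have "\<dots> \<le> c"
    using assms N K by (intro Max.boundedI) (auto simp: lessThan_empty_iff)
  finally show ?thesis .
qed

lemma G_constant: "G (\<lambda>b k j. q b) = (MAX b. q b)"
  using G1[unfolded G_consistent_def, rule_format, of "\<lambda>b k j. q b" 1 0] N K by simp

text \<open>(G2) makes \<open>G\<close> a continuous function of finitely many coordinates, hence
  Borel.\<close>

lemma G_measurable:
  assumes X: "\<And>b k j. k \<in> {1..N} \<Longrightarrow> j < K \<Longrightarrow> X b k j \<in> borel_measurable A"
  shows "(\<lambda>\<omega>. G (\<lambda>b k j. X b k j \<omega>)) \<in> borel_measurable A"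
proof -
  define I where "I = (UNIV :: 'a set) \<times> {1..N} \<times> {..<K}"
  have "finite I" by (simp add: I_def)
  define H where "H x = G (\<lambda>b k j. x (b, k, j))" for x :: "'a \<times> nat \<times> nat \<Rightarrow> real"
  have H: "\<bar>H y - H x\<bar> \<le> (\<Sum>i\<in>I. \<bar>y i - x i\<bar>)" for x y
    unfolding H_def
  proof (rule G_diff_le)
    fix b k j assume "k \<in> {1..N}" "j < K"
    then show "\<bar>y (b, k, j) - x (b, k, j)\<bar> \<le> (\<Sum>i\<in>I. \<bar>y i - x i\<bar>)"
      using \<open>finite I\<close> by (intro member_le_sum[where f = "\<lambda>i. \<bar>y i - x i\<bar>"]) (auto simp: I_def)
  qed
  have "isCont H x" for x
    unfolding isCont_def
  proof (rule LIM_zero_cancel, rule Lim_null_comparison)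
    show "\<forall>\<^sub>F y in at x. norm (H y - H x) \<le> (\<Sum>i\<in>I. \<bar>y i - x i\<bar>)"
      using H by (intro always_eventually allI) simp
    have "isCont (\<lambda>y :: 'a \<times> nat \<times> nat \<Rightarrow> real. y i) x" for i
      using continuous_on_product_coordinates[of i]
      by (rule continuous_on_interior) simp
    then have "((\<lambda>y. y i) \<longlongrightarrow> x i) (at x)" for i
      unfolding isCont_def .
    then have "((\<lambda>y. \<Sum>i\<in>I. \<bar>y i - x i\<bar>) \<longlongrightarrow> (\<Sum>i\<in>I. \<bar>x i - x i\<bar>)) (at x)"
      by (intro tendsto_intros)
    then show "((\<lambda>y. \<Sum>i\<in>I. \<bar>y i - x i\<bar>) \<longlongrightarrow> 0) (at x)" by simp
  qed
  then have Hm: "H \<in> borel_measurable borel"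
    by (intro borel_measurable_continuous_onI) (simp add: continuous_on_eq_continuous_at)
  \<comment> \<open>Coordinates outside the index range are set to 0, as nothing is known about
    their measurability; \<open>G\<close> does not see them.\<close>
  define Y where "Y \<omega> = (\<lambda>(b, k, j). if k \<in> {1..N} \<and> j < K then X b k j \<omega> else 0)" for \<omega>
  have Ym: "Y \<in> borel_measurable A"
  proof (rule measurable_coordinatewise_then_product)
    fix i :: "'a \<times> nat \<times> nat"
    obtain b k j where i: "i = (b, k, j)" by (cases i)
    show "(\<lambda>\<omega>. Y \<omega> i) \<in> borel_measurable A"
      using X[of k j b] by (cases "k \<in> {1..N} \<and> j < K") (auto simp: Y_def i)
  qed
  have "\<bar>G (\<lambda>b k j. X b k j \<omega>) - H (Y \<omega>)\<bar> \<le> 0" for \<omega>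
    unfolding H_def by (rule G_diff_le) (simp add: Y_def)
  then have "(\<lambda>\<omega>. G (\<lambda>b k j. X b k j \<omega>)) = (\<lambda>\<omega>. H (Y \<omega>))" by (auto simp: fun_eq_iff)
  then show ?thesis using measurable_compose[OF Ym Hm] by simp
qed

definition target :: "nat \<Rightarrow> 's \<Rightarrow> 'w \<Rightarrow> real" where
  "target t s' \<omega> = G (\<lambda>b k j. Q (int t - int j) k s' b \<omega>)"

lemma Q_Suc:
  assumes "i \<in> {1..N}" "\<omega> \<in> space M"
  shows "Q (int (Suc t)) i s a \<omega> = Q (int t) i s a \<omega> +
    \<alpha> t i s a \<omega> * (r t s a \<omega> + \<gamma> * target t (f t s a \<omega>) \<omega> - Q (int t) i s a \<omega>)"
  using iteration[OF assms, of t s a] by (simp add: target_def add.commute)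

lemma measurable_F_mono:
  assumes "s \<le> t" "Y \<in> F s \<rightarrow>\<^sub>M L"
  shows "Y \<in> F t \<rightarrow>\<^sub>M L"
  by (rule measurable_from_subalg[OF _ assms(2)])
    (use history(2)[of s] history(2)[of t] F_mono[OF assms(1)] in \<open>simp add: subalgebra_def\<close>)

lemma Q_target_measurable:
  shows "i \<in> {1..N} \<Longrightarrow> \<tau> \<in> {- int K + 1..int t} \<Longrightarrow> Q \<tau> i s a \<in> borel_measurable (F t)"
    and "target t s' \<in> borel_measurable (F t)"
proof -
  \<comment> \<open>Stated relative to measurability of the estimates, so that the induction step
    can apply it to the induction hypothesis.\<close>
  have target: "target t s' \<in> borel_measurable (F t)"
    if "\<And>\<tau> i s a. i \<in> {1..N} \<Longrightarrow> \<tau> \<in> {- int K + 1..int t} \<Longrightarrow> Q \<tau> i s a \<in> borel_measurable (F t)" for t s'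
    unfolding target_def[abs_def] by (rule G_measurable) (use that in auto)
  have Q: "Q \<tau> i s a \<in> borel_measurable (F t)"
    if "i \<in> {1..N}" "\<tau> \<in> {- int K + 1..int t}" for i \<tau> s a t
    using that
  proof (induction t arbitrary: \<tau> i s a)
    case 0
    then show ?case using initial_measurable by simp
  next
    case (Suc t)
    show ?case
    proof (cases "\<tau> = int (Suc t)")
      case True
      have [measurable]: "Q (int t) i s a \<in> borel_measurable (F (Suc t))"
        "\<alpha> t i s a \<in> borel_measurable (F (Suc t))"
        using Suc.prems(1) Suc.IH[of i "int t"] step_measurable K
        by (auto intro: measurable_F_mono[of t])
      have [measurable]: "(\<lambda>\<omega>. target t (f t s a \<omega>) \<omega>) \<in> borel_measurable (F (Suc t))"
      proof (rule measurable_compose_countable[where f = "target t"])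
        show "target t s' \<in> borel_measurable (F (Suc t))" for s'
          by (rule measurable_F_mono[OF _ target]) (simp, rule Suc.IH)
        show "f t s a \<in> F (Suc t) \<rightarrow>\<^sub>M count_space UNIV" by (rule samples_adapted)
      qed
      have [measurable]: "r t s a \<in> borel_measurable (F (Suc t))" by (rule samples_adapted)
      have "(\<lambda>\<omega>. Q (int t) i s a \<omega> +
          \<alpha> t i s a \<omega> * (r t s a \<omega> + \<gamma> * target t (f t s a \<omega>) \<omega> - Q (int t) i s a \<omega>))
          \<in> borel_measurable (F (Suc t))" by measurable
      moreover have "space (F (Suc t)) = space M" using history(2) by (simp add: subalgebra_def)
      ultimately show ?thesis
        unfolding True using Q_Suc[OF Suc.prems(1)] by (subst measurable_cong) auto
    next
      case False
      then show ?thesis using Suc.prems Suc.IH by (intro measurable_F_mono[of t "Suc t"]) auto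
    qed
  qed
  show "i \<in> {1..N} \<Longrightarrow> \<tau> \<in> {- int K + 1..int t} \<Longrightarrow> Q \<tau> i s a \<in> borel_measurable (F t)" by (rule Q)
  show "target t s' \<in> borel_measurable (F t)" by (rule target) (rule Q)
qed

abbreviation q_opt :: "'s \<Rightarrow> 'a \<Rightarrow> real" where "q_opt \<equiv> opt_q p R \<gamma>"
abbreviation v_opt :: "'s \<Rightarrow> real" where "v_opt \<equiv> opt_value p R \<gamma>"

lemma q_opt_0:
  assumes "\<xi> s = 0"
  shows "q_opt s a = 0"
proof -
  obtain c where c: "0 \<le> c" "\<And>s. \<bar>v_opt s\<bar> \<le> c * \<xi> s" using opt_value_bound by blast
  have "\<bar>q_backup p R \<gamma> v_opt s a - q_backup p R \<gamma> (\<lambda>_. 0) s a\<bar> \<le> \<beta> * c * \<xi> s"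
    by (rule q_backup_diff) (use c in auto)
  then show ?thesis using assms reward_0[OF assms] by (simp add: opt_q_eq q_backup_def)
qed

text \<open>By (G1) and the optimality equation, \<open>v_opt\<close> is the value of
  \<open>G\<close> on the array filled with \<open>q_opt\<close>; (G2) then compares the two
  arrays.\<close>

lemma target_diff_le:
  assumes "\<And>k b j. k \<in> {1..N} \<Longrightarrow> j < K \<Longrightarrow> \<bar>Q (int t - int j) k s' b \<omega> - q_opt s' b\<bar> \<le> c"
  shows "\<bar>target t s' \<omega> - v_opt s'\<bar> \<le> c"
  using G_diff_le[of "\<lambda>b k j. Q (int t - int j) k s' b \<omega>" "\<lambda>b k j. q_opt s' b" c] assms
  by (simp add: target_def G_constant opt_value_eq_Max)

text \<open>At weight zero, \<open>weight\<close> bounds a sum of nonnegative terms by zero, so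
  unless \<open>\<gamma> = 0\<close> every possible successor has weight zero too.\<close>

lemma AE_weightless:
  "AE \<omega> in M. \<forall>t s a. \<xi> s = 0 \<longrightarrow> r t s a \<omega> = 0 \<and> (\<gamma> = 0 \<or> \<xi> (f t s a \<omega>) = 0)"
proof -
  have "AE \<omega> in M. r t s a \<omega> = 0 \<and> (\<gamma> = 0 \<or> \<xi> (f t s a \<omega>) = 0)" if "\<xi> s = 0" for t s a
  proof -
    have "AE \<omega> in M. r t s a \<omega> = 0"
      using AE_distrD[OF r_measurable[of t s a], unfolded distr_r, OF reward_AE_0[OF that]] .
    moreover have "AE \<omega> in M. f t s a \<omega> \<in> set_pmf (p s a)"
      using AE_distrD[OF f_measurable[of t s a], unfolded distr_f, OF AE_measure_pmf] .
    ultimately show ?thesis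
    proof eventually_elim
      case (elim \<omega>)
      have nn: "0 \<le> pmf (p s a) s' * \<xi> s'" for s' using \<xi> by simp
      have "\<gamma> = 0 \<or> (\<Sum>s'\<in>UNIV. pmf (p s a) s' * \<xi> s') = 0"
      proof -
        have "0 \<le> (\<Sum>s'\<in>UNIV. pmf (p s a) s' * \<xi> s')" by (intro sum_nonneg nn)
        moreover have "\<gamma> * (\<Sum>s'\<in>UNIV. pmf (p s a) s' * \<xi> s') \<le> 0" using weight[of s a] that by simp
        ultimately show ?thesis using \<gamma> by (auto simp: mult_le_0_iff)
      qed
      moreover have "pmf (p s a) (f t s a \<omega>) \<noteq> 0" using elim by (simp add: set_pmf_iff)
      ultimately show ?case using elim nn by (auto simp: sum_nonneg_eq_0_iff)
    qed
  qed
  then show ?thesis by (simp add: AE_all_countable)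
qed

text \<open>An error bound proportional to \<open>\<xi>\<close> can hold at a state of weight zero
  only if the estimates there equal the optimal value 0 exactly.\<close>

lemma AE_Q_0:
  "AE \<omega> in M. \<forall>s a. \<forall>i\<in>{1..N}. \<forall>\<tau>\<ge>- int K + 1. \<xi> s = 0 \<longrightarrow> Q \<tau> i s a \<omega> = 0"
  using AE_weightless AE_space
proof eventually_elim
  case (elim \<omega>)
  have "Q \<tau> i s a \<omega> = 0" if "\<xi> s = 0" "i \<in> {1..N}" "\<tau> \<in> {- int K + 1..int t}" for s a i \<tau> t
    using that
  proof (induction t arbitrary: s a i \<tau>)
    case 0
    then show ?case using initial_0 elim by simp
  next
    case (Suc t)
    show ?case
    proof (cases "\<tau> = int (Suc t)")
      case True
      have "target t s' \<omega> = 0" if "\<xi> s' = 0" for s'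
      proof -
        have "\<bar>target t s' \<omega> - G (\<lambda>b k j. 0)\<bar> \<le> 0"
          unfolding target_def by (rule G_diff_le) (use Suc.IH[OF that] in simp)
        then show ?thesis by (simp add: G_constant)
      qed
      moreover have "Q (int t) i s a \<omega> = 0" using Suc.IH[of s i "int t"] Suc.prems K by simp
      ultimately show ?thesis
        unfolding True Q_Suc[OF Suc.prems(2) elim(2)] using elim(1) Suc.prems(1) by auto
    next
      case False
      then show ?thesis using Suc by auto
    qed
  qed
  then show ?case by (meson atLeastAtMost_iff nat_le_iff order_refl)
qed

text \<open>Where \<open>\<xi>\<close> vanishes the error vanishes almost surely, so any positive weight will do; this
  keeps the bounds involving \<open>scale\<close> below valid on the whole of \<open>space M\<close>.\<close>

definition \<eta> :: "'s \<Rightarrow> real" where "\<eta> s = (if \<xi> s = 0 then 1 else \<xi> s)"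

lemma \<eta>: "0 < \<eta> s" "\<xi> s \<le> \<eta> s"
  using \<xi>[of s] by (auto simp: \<eta>_def)

definition err :: "int \<Rightarrow> nat \<Rightarrow> 's \<Rightarrow> 'a \<Rightarrow> 'w \<Rightarrow> real" where
  "err \<tau> i s a \<omega> = (Q \<tau> i s a \<omega> - q_opt s a) / \<eta> s"

text \<open>Including the initial times makes \<open>scale t\<close> dominate every error that the
  target at time \<open>t\<close> reads; the added 1 keeps it away from zero.\<close>

definition scale :: "nat \<Rightarrow> 'w \<Rightarrow> real" where
  "scale t \<omega> = 1 + Max ((\<lambda>(\<tau>, i, s, a). \<bar>err \<tau> i s a \<omega>\<bar>) ` ({- int K + 1..int t} \<times> {1..N} \<times> UNIV \<times> UNIV))"

lemma err_le_scale:
  assumes "\<tau> \<in> {- int K + 1..int t}" "i \<in> {1..N}"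
  shows "\<bar>err \<tau> i s a \<omega>\<bar> \<le> scale t \<omega> - 1"
  unfolding scale_def using assms
  by (auto intro!: Max_ge image_eqI[where x = "(\<tau>, i, s, a)"])

lemma scale_ge_1: "1 \<le> scale t \<omega>"
  using err_le_scale[of 0 t 1 undefined undefined \<omega>] N K by (simp add: abs_le_iff)

lemma scale_le:
  assumes "\<And>\<tau> i s a. \<tau> \<in> {- int K + 1..int t} \<Longrightarrow> i \<in> {1..N} \<Longrightarrow> \<bar>err \<tau> i s a \<omega>\<bar> \<le> B"
  shows "scale t \<omega> \<le> 1 + B"
  unfolding scale_def using assms N K by (intro add_left_mono Max.boundedI) auto

lemma scale_mono: "scale t \<omega> \<le> scale (Suc t) \<omega>"
  using scale_le[of t \<omega> "scale (Suc t) \<omega> - 1"] err_le_scale[of _ "Suc t"] by simp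

lemma scale_measurable: "scale t \<in> borel_measurable (F t)"
  unfolding scale_def[abs_def]
proof (intro borel_measurable_add borel_measurable_const borel_measurable_Max)
  fix x assume x: "x \<in> {- int K + 1..int t} \<times> {1..N} \<times> (UNIV :: 's set) \<times> (UNIV :: 'a set)"
  then obtain \<tau> i s a where [simp]: "x = (\<tau>, i, s, a)" and "i \<in> {1..N}" "\<tau> \<in> {- int K + 1..int t}" by auto
  then have [measurable]: "Q \<tau> i s a \<in> borel_measurable (F t)" using Q_target_measurable(1) by blast
  show "(\<lambda>\<omega>. case x of (\<tau>, i, s, a) \<Rightarrow> \<bar>err \<tau> i s a \<omega>\<bar>) \<in> borel_measurable (F t)"
    unfolding err_def by simp
qed auto

lemma Q_diff_le_scale:
  assumes "\<tau> \<in> {- int K + 1..int t}" "i \<in> {1..N}"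
  shows "\<bar>Q \<tau> i s a \<omega> - q_opt s a\<bar> \<le> \<eta> s * (scale t \<omega> - 1)"
  using err_le_scale[OF assms, of s a \<omega>] \<eta>(1)[of s]
  by (simp add: err_def divide_le_eq mult.commute)

text \<open>The target grows at most linearly with the scale, so the quotient is a coefficient
  bounded uniformly in time and sample point.\<close>

lemma target_le_scale: "\<bar>target t s' \<omega> / scale t \<omega>\<bar> \<le> \<bar>v_opt s'\<bar> + \<eta> s'"
proof -
  have "\<bar>target t s' \<omega> - v_opt s'\<bar> \<le> \<eta> s' * (scale t \<omega> - 1)"
    by (rule target_diff_le) (auto intro!: Q_diff_le_scale)
  then have "\<bar>target t s' \<omega>\<bar> \<le> \<bar>v_opt s'\<bar> + \<eta> s' * scale t \<omega>"
    using \<eta>(1)[of s'] by (simp add: right_diff_distrib)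
  also have "\<bar>v_opt s'\<bar> \<le> \<bar>v_opt s'\<bar> * scale t \<omega>"
    using mult_left_mono[OF scale_ge_1[of t \<omega>], of "\<bar>v_opt s'\<bar>"] by simp
  finally show ?thesis using scale_ge_1[of t \<omega>] by (simp add: divide_le_eq distrib_right)
qed

lemma AE_step_transform_convergent:
  assumes z: "independent_innovations M F z v" and i: "i \<in> {1..N}"
    and u: "\<And>t. u t \<in> borel_measurable (F t)" "\<And>t \<omega>. \<bar>u t \<omega>\<bar> \<le> c"
  shows "AE \<omega> in M. convergent (\<lambda>n. \<Sum>t<n. \<alpha> t i s a \<omega> * u t \<omega> * z t \<omega>)"
proof -
  interpret independent_innovations M F z v by fact
  have c: "0 \<le> c" using u(2)[of 0 undefined] by linarith
  have bd: "\<bar>\<alpha> t i s a \<omega> * u t \<omega>\<bar> \<le> \<alpha> t i s a \<omega> * c" if "\<omega> \<in> space M" for t \<omega>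
    unfolding abs_mult using step_range[OF i that, of t s a] u(2) by (intro mult_mono) auto
  show ?thesis
  proof (rule transform_convergent)
    show "(\<lambda>\<omega>. \<alpha> t i s a \<omega> * u t \<omega>) \<in> borel_measurable (F t)" for t
      using step_measurable[OF i] u(1) by (rule borel_measurable_times)
    show "\<bar>\<alpha> t i s a \<omega> * u t \<omega>\<bar> \<le> c" if "\<omega> \<in> space M" for t \<omega>
      using bd[OF that, of t] mult_right_mono[OF conjunct2[OF step_range[OF i that, of t s a]] c] by simp
    show "AE \<omega> in M. summable (\<lambda>t. (\<alpha> t i s a \<omega> * u t \<omega>)\<^sup>2) \<and> (\<Sum>t. (\<alpha> t i s a \<omega> * u t \<omega>)\<^sup>2) \<le> C * c\<^sup>2"
      using step_squares[OF i, of s a] AE_space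
    proof eventually_elim
      case (elim \<omega>)
      have le: "(\<alpha> t i s a \<omega> * u t \<omega>)\<^sup>2 \<le> (\<alpha> t i s a \<omega>)\<^sup>2 * c\<^sup>2" for t
        using power_mono[OF bd[OF elim(2), of t] abs_ge_zero, of 2] by (simp add: power_mult_distrib)
      have sm: "summable (\<lambda>t. (\<alpha> t i s a \<omega>)\<^sup>2 * c\<^sup>2)" using elim by (intro summable_mult2) auto
      have sm': "summable (\<lambda>t. (\<alpha> t i s a \<omega> * u t \<omega>)\<^sup>2)"
        by (rule summable_comparison_test'[OF sm, of 0]) (use le in simp)
      have "(\<Sum>t. (\<alpha> t i s a \<omega> * u t \<omega>)\<^sup>2) \<le> (\<Sum>t. (\<alpha> t i s a \<omega>)\<^sup>2 * c\<^sup>2)"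
        by (rule suminf_le[OF le sm' sm])
      also have "\<dots> = (\<Sum>t. (\<alpha> t i s a \<omega>)\<^sup>2) * c\<^sup>2"
        using elim by (intro suminf_mult2[symmetric]) auto
      also have "\<dots> \<le> C * c\<^sup>2" using elim by (intro mult_right_mono) auto
      finally show ?case using sm' by blast
    qed
  qed
qed

section \<open>Drift and noise of the weighted errors\<close>

definition drift :: "nat \<Rightarrow> 's \<Rightarrow> 'a \<Rightarrow> 'w \<Rightarrow> real" where
  "drift t s a \<omega> = \<gamma> * (\<Sum>s'\<in>UNIV. pmf (p s a) s' * (target t s' \<omega> - v_opt s')) / \<eta> s"

definition noise :: "nat \<Rightarrow> 's \<Rightarrow> 'a \<Rightarrow> 'w \<Rightarrow> real" where
  "noise t s a \<omega> = (r t s a \<omega> - mean_reward R s a +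
    \<gamma> * (\<Sum>s'\<in>UNIV. (of_bool (f t s a \<omega> = s') - pmf (p s a) s') * target t s' \<omega>)) / \<eta> s"

text \<open>The means subtracted in \<open>noise\<close> and the values subtracted in
  \<open>drift\<close> recombine to \<open>q_opt\<close> by its definition, and the sum of
  indicators picks out the sampled successor.\<close>

lemma err_Suc:
  assumes "i \<in> {1..N}" "\<omega> \<in> space M"
  shows "err (int (Suc t)) i s a \<omega> = err (int t) i s a \<omega> +
    \<alpha> t i s a \<omega> * (drift t s a \<omega> + noise t s a \<omega> - err (int t) i s a \<omega>)"
proof -
  have "(\<Sum>s'\<in>UNIV. of_bool (f t s a \<omega> = s') * target t s' \<omega>) = target t (f t s a \<omega>) \<omega>"
    by (subst sum.remove[of _ "f t s a \<omega>"]) (auto intro: sum.neutral)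
  then have "\<eta> s * (drift t s a \<omega> + noise t s a \<omega> - err (int t) i s a \<omega>) =
      r t s a \<omega> + \<gamma> * target t (f t s a \<omega>) \<omega> - Q (int t) i s a \<omega>"
    using \<eta>(1)[of s]
    by (simp add: drift_def noise_def err_def opt_q_eq q_backup_def ring_distribs
        sum_subtractf add_divide_distrib diff_divide_distrib)
  then have "Q (int (Suc t)) i s a \<omega> = Q (int t) i s a \<omega> +
      \<alpha> t i s a \<omega> * (\<eta> s * (drift t s a \<omega> + noise t s a \<omega> - err (int t) i s a \<omega>))"
    using Q_Suc[OF assms] by simp
  moreover have "Q \<tau> i s a \<omega> = \<eta> s * err \<tau> i s a \<omega> + q_opt s a" for \<tau>
    using \<eta>(1)[of s] by (simp add: err_def)
  ultimately have "\<eta> s * err (int (Suc t)) i s a \<omega> = \<eta> s * (err (int t) i s a \<omega> +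
      \<alpha> t i s a \<omega> * (drift t s a \<omega> + noise t s a \<omega> - err (int t) i s a \<omega>))"
    by (simp only:) (simp add: algebra_simps)
  then show ?thesis using \<eta>(1)[of s] by (simp only: mult_cancel_left) simp
qed

text \<open>Errors are measured with \<open>\<eta>\<close>, the contraction with
  \<open>\<xi>\<close>. The two differ only where \<open>\<xi>\<close> vanishes, and there the
  estimates are exact.\<close>

lemma drift_le:
  assumes zero: "\<And>s a i \<tau>. i \<in> {1..N} \<Longrightarrow> \<tau> \<ge> - int K + 1 \<Longrightarrow> \<xi> s = 0 \<Longrightarrow> Q \<tau> i s a \<omega> = 0"
    and "0 \<le> B"
    and B: "\<And>k s b j. k \<in> {1..N} \<Longrightarrow> j < K \<Longrightarrow> \<bar>err (int t - int j) k s b \<omega>\<bar> \<le> B"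
  shows "\<bar>drift t s a \<omega>\<bar> \<le> \<beta> * B"
proof -
  have "\<bar>target t s' \<omega> - v_opt s'\<bar> \<le> B * \<xi> s'" for s'
  proof (rule target_diff_le)
    fix k b j assume kj: "k \<in> {1..N}" "j < K"
    show "\<bar>Q (int t - int j) k s' b \<omega> - q_opt s' b\<bar> \<le> B * \<xi> s'"
    proof (cases "\<xi> s' = 0")
      case True
      then show ?thesis using zero[OF kj(1), of "int t - int j" s' b] kj(2) q_opt_0[OF True] by simp
    next
      case False
      then show ?thesis using B[OF kj, of s' b] \<eta>(1)[of s'] by (simp add: err_def \<eta>_def divide_le_eq)
    qed
  qed
  then have "\<bar>q_backup p R \<gamma> (\<lambda>s'. target t s' \<omega>) s a - q_backup p R \<gamma> v_opt s a\<bar> \<le> \<beta> * B * \<xi> s"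
    using \<open>0 \<le> B\<close> by (intro q_backup_diff)
  also have "\<dots> \<le> \<beta> * B * \<eta> s" using \<eta>(2)[of s] \<beta> \<open>0 \<le> B\<close> by (intro mult_left_mono) auto
  also have "q_backup p R \<gamma> (\<lambda>s'. target t s' \<omega>) s a - q_backup p R \<gamma> v_opt s a = drift t s a \<omega> * \<eta> s"
    using \<eta>(1)[of s] by (simp add: drift_def q_backup_def right_diff_distrib sum_subtractf)
  finally show ?thesis using \<eta>(1)[of s] by (simp add: abs_mult)
qed

text \<open>Divided by the scale, the noise is a finite combination of transform terms: the reward
  innovation with coefficient \<open>1 / scale\<close>, and the indicator of each \<open>s'\<close>
  with coefficient \<open>target / scale\<close>.\<close>

lemma AE_noise_convergent:
  assumes "i \<in> {1..N}"
  shows "AE \<omega> in M. convergent (\<lambda>n. \<Sum>t<n. \<alpha> t i s a \<omega> * noise t s a \<omega> / scale t \<omega>)"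
proof -
  have 1: "AE \<omega> in M. convergent (\<lambda>n. \<Sum>t<n. \<alpha> t i s a \<omega> * (1 / scale t \<omega>) * (r t s a \<omega> - mean_reward R s a))"
  proof (rule AE_step_transform_convergent[OF reward_innovations assms])
    show "(\<lambda>\<omega>. 1 / scale t \<omega>) \<in> borel_measurable (F t)" for t
      using scale_measurable by measurable
    show "\<bar>1 / scale t \<omega>\<bar> \<le> 1" for t \<omega> using scale_ge_1[of t \<omega>] by simp
  qed
  have "AE \<omega> in M. convergent (\<lambda>n. \<Sum>t<n. \<alpha> t i s a \<omega> * (target t s' \<omega> / scale t \<omega>) *
      (of_bool (f t s a \<omega> = s') - pmf (p s a) s'))" for s'
    by (rule AE_step_transform_convergent[OF transition_innovations assms _ target_le_scale])
      (intro borel_measurable_divide scale_measurable Q_target_measurable(2))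
  then have "AE \<omega> in M. \<forall>s'. convergent (\<lambda>n. \<Sum>t<n. \<alpha> t i s a \<omega> * (target t s' \<omega> / scale t \<omega>) *
      (of_bool (f t s a \<omega> = s') - pmf (p s a) s'))"
    by (subst AE_all_countable) simp
  with 1 show ?thesis
  proof eventually_elim
    case (elim \<omega>)
    let ?x = "\<lambda>t. \<alpha> t i s a \<omega> * (1 / scale t \<omega>) * (r t s a \<omega> - mean_reward R s a)"
    let ?y = "\<lambda>s' t. \<alpha> t i s a \<omega> * (target t s' \<omega> / scale t \<omega>) * (of_bool (f t s a \<omega> = s') - pmf (p s a) s')"
    have eq: "\<alpha> t i s a \<omega> * noise t s a \<omega> / scale t \<omega> = (?x t + \<gamma> * (\<Sum>s'\<in>UNIV. ?y s' t)) / \<eta> s" for t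
      by (simp add: noise_def add_divide_distrib distrib_left sum_distrib_left sum_divide_distrib mult_ac)
    have "(\<Sum>t<n. \<alpha> t i s a \<omega> * noise t s a \<omega> / scale t \<omega>) =
        ((\<Sum>t<n. ?x t) + \<gamma> * (\<Sum>s'\<in>UNIV. \<Sum>t<n. ?y s' t)) / \<eta> s" for n
      unfolding eq sum.swap[of _ _ UNIV]
      by (simp only: sum.distrib flip: sum_divide_distrib sum_distrib_left)
    moreover have "(\<lambda>n. \<Sum>t<n. ?x t) \<longlonglongrightarrow> lim (\<lambda>n. \<Sum>t<n. ?x t)"
      "(\<lambda>n. \<Sum>t<n. ?y s' t) \<longlonglongrightarrow> lim (\<lambda>n. \<Sum>t<n. ?y s' t)" for s'
      using elim by (auto simp: convergent_LIMSEQ_iff)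
    then have "(\<lambda>n. ((\<Sum>t<n. ?x t) + \<gamma> * (\<Sum>s'\<in>UNIV. \<Sum>t<n. ?y s' t)) / \<eta> s) \<longlonglongrightarrow>
        (lim (\<lambda>n. \<Sum>t<n. ?x t) + \<gamma> * (\<Sum>s'\<in>UNIV. lim (\<lambda>n. \<Sum>t<n. ?y s' t))) / \<eta> s"
      using \<eta>(1)[of s] by (intro tendsto_intros) auto
    ultimately show ?case by (simp only:) (rule convergentI)
  qed
qed

theorem Q_tendsto:
  "AE \<omega> in M. \<forall>i\<in>{1..N}. \<forall>s a. (\<lambda>t. Q (int t) i s a \<omega>) \<longlonglongrightarrow> q_opt s a"
proof -
  have "AE \<omega> in M. \<forall>i\<in>{1..N}. \<forall>s a. convergent (\<lambda>n. \<Sum>t<n. \<alpha> t i s a \<omega> * noise t s a \<omega> / scale t \<omega>)"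
    by (intro AE_finite_allI) (simp_all add: AE_all_countable AE_noise_convergent)
  moreover have "AE \<omega> in M. \<forall>i\<in>{1..N}. \<forall>s a. filterlim (\<lambda>n. \<Sum>t<n. \<alpha> t i s a \<omega>) at_top sequentially"
    by (intro AE_finite_allI) (simp_all add: AE_all_countable step_diverges)
  ultimately show ?thesis
    using AE_Q_0 AE_space
  proof eventually_elim
    case (elim \<omega>)
    define I where "I = {1..N} \<times> (UNIV :: 's set) \<times> (UNIV :: 'a set)"
    define e where "e t = (\<lambda>(i, s, a). err (int t) i s a \<omega>)" for t
    define A where "A t = (\<lambda>(i, s, a). \<alpha> t i s a \<omega>)" for t
    define h where "h t = (\<lambda>(i :: nat, s, a). drift t s a \<omega>)" for t
    define w where "w t = (\<lambda>(i :: nat, s, a). noise t s a \<omega>)" for t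
    \<comment> \<open>The sample point is fixed from here on. \<open>scale 0\<close> dominates the
      errors at all initial times, which qualifies it as the threshold
      \<open>B\<^sub>0\<close>.\<close>
    interpret async_averaging I e h w A "\<lambda>t. scale t \<omega>" \<beta> "scale 0 \<omega>" K
    proof
      show "finite I" by (simp add: I_def)
      show "0 \<le> \<beta>" "\<beta> < 1" by (rule \<beta>)+
      show "0 < scale t \<omega>" "scale t \<omega> \<le> scale (Suc t) \<omega>" for t
        using scale_ge_1[of t \<omega>] scale_mono by auto
      have early: "\<bar>err \<tau> i s a \<omega>\<bar> \<le> B"
        if "scale 0 \<omega> \<le> B" "\<And>\<tau> l. l \<in> I \<Longrightarrow> \<tau> \<le> t \<Longrightarrow> \<bar>e \<tau> l\<bar> \<le> B" "i \<in> {1..N}"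
          "\<tau> \<in> {- int K + 1..int t}" for B t \<tau> i s a
      proof (cases "\<tau> \<le> 0")
        case True
        then show ?thesis using err_le_scale[of \<tau> 0 i s a \<omega>] that by simp
      next
        case False
        then have "nat \<tau> \<le> t" "int (nat \<tau>) = \<tau>" using that(4) by auto
        then show ?thesis using that(2)[of "(i, s, a)" "nat \<tau>"] that(3) by (simp add: I_def e_def)
      qed
      show "scale t \<omega> \<le> 1 + B"
        if "scale 0 \<omega> \<le> B" "\<And>\<tau> l. l \<in> I \<Longrightarrow> \<tau> \<le> t \<Longrightarrow> \<bar>e \<tau> l\<bar> \<le> B" for t B
        by (rule scale_le) (rule early[OF that])
      show "\<bar>h t k\<bar> \<le> \<beta> * B"
        if "k \<in> I" "scale 0 \<omega> \<le> B" "\<And>\<tau> l. l \<in> I \<Longrightarrow> \<tau> \<le> t \<Longrightarrow> \<bar>e \<tau> l\<bar> \<le> B" for t B k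
      proof -
        have "\<bar>drift t s a \<omega>\<bar> \<le> \<beta> * B" for s a
        proof (rule drift_le)
          show "0 \<le> B" using that(2) scale_ge_1[of 0 \<omega>] by simp
          show "\<bar>err (int t - int j) i s a \<omega>\<bar> \<le> B" if "i \<in> {1..N}" "j < K" for i s a j
            using early[OF \<open>scale 0 \<omega> \<le> B\<close>, of t i "int t - int j" s a]
              \<open>\<And>\<tau> l. l \<in> I \<Longrightarrow> \<tau> \<le> t \<Longrightarrow> \<bar>e \<tau> l\<bar> \<le> B\<close> that by auto
        qed (use elim in blast)
        then show ?thesis by (simp add: h_def split: prod.split)
      qed
      show "\<bar>h t k\<bar> \<le> \<beta> * B"
        if "k \<in> I" "0 \<le> B" "m + K \<le> t" "\<And>\<tau> l. l \<in> I \<Longrightarrow> m \<le> \<tau> \<Longrightarrow> \<tau> \<le> t \<Longrightarrow> \<bar>e \<tau> l\<bar> \<le> B"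
        for m t B k
      proof -
        have "\<bar>drift t s a \<omega>\<bar> \<le> \<beta> * B" for s a
        proof (rule drift_le[OF _ \<open>0 \<le> B\<close>])
          show "\<bar>err (int t - int j) i s a \<omega>\<bar> \<le> B" if "i \<in> {1..N}" "j < K" for i s a j
          proof -
            \<comment> \<open>As \<open>m + K \<le> t\<close>, no lag \<open>j < K\<close> reaches
              back before \<open>m\<close>, so no initial value at a negative time is read.\<close>
            have eq: "int t - int j = int (t - j)" and "m \<le> t - j" using \<open>m + K \<le> t\<close> that by auto
            then have "\<bar>e (t - j) (i, s, a)\<bar> \<le> B"
              using that(1) by (intro \<open>\<And>\<tau> l. l \<in> I \<Longrightarrow> m \<le> \<tau> \<Longrightarrow> \<tau> \<le> t \<Longrightarrow> \<bar>e \<tau> l\<bar> \<le> B\<close>) (auto simp: I_def)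
            then show ?thesis unfolding eq by (simp only: e_def prod.case)
          qed
        qed (use elim in blast)
        then show ?thesis by (simp add: h_def split: prod.split)
      qed
      fix k assume "k \<in> I"
      then obtain i s a where k: "k = (i, s, a)" "i \<in> {1..N}" by (auto simp: I_def)
      show "e (Suc t) k = e t k + A t k * (h t k + w t k - e t k)" for t
        using err_Suc[OF k(2), of \<omega> t s a] elim by (simp add: k(1) e_def A_def h_def w_def)
      show "0 \<le> A t k" "A t k \<le> 1" for t
        using step_range[OF k(2), of \<omega> t s a] elim by (simp_all add: k(1) A_def)
      show "filterlim (\<lambda>n. \<Sum>t<n. A t k) at_top sequentially"
        using elim(2) k by (simp add: A_def)
      show "convergent (\<lambda>n. \<Sum>t<n. A t k * w t k / scale t \<omega>)"
        using elim(1) k by (simp add: A_def w_def)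
    qed
    show ?case
    proof (intro ballI allI)
      fix i s a assume "i \<in> {1..N}"
      then have "(\<lambda>t. err (int t) i s a \<omega>) \<longlonglongrightarrow> 0"
        using tendsto_0[of "(i, s, a)"] by (simp add: I_def e_def)
      then have "(\<lambda>t. \<eta> s * err (int t) i s a \<omega> + q_opt s a) \<longlonglongrightarrow> \<eta> s * 0 + q_opt s a"
        by (intro tendsto_intros)
      then show "(\<lambda>t. Q (int t) i s a \<omega>) \<longlonglongrightarrow> q_opt s a"
        using \<eta>(1)[of s] by (simp add: err_def)
    qed
  qed
qed

end

theorem theorem2:
  fixes p :: "'s::finite \<Rightarrow> 'a::finite \<Rightarrow> 's pmf"
    and R :: "'s \<Rightarrow> 'a \<Rightarrow> real measure"
    and \<gamma> C :: real
    and N K :: nat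
    and G :: "('a \<Rightarrow> nat \<Rightarrow> nat \<Rightarrow> real) \<Rightarrow> real"
    and M :: "'w measure"
    and F :: "nat \<Rightarrow> 'w measure"
    and \<alpha> :: "nat \<Rightarrow> nat \<Rightarrow> 's \<Rightarrow> 'a \<Rightarrow> 'w \<Rightarrow> real"
    and r :: "nat \<Rightarrow> 's \<Rightarrow> 'a \<Rightarrow> 'w \<Rightarrow> real"
    and f :: "nat \<Rightarrow> 's \<Rightarrow> 'a \<Rightarrow> 'w \<Rightarrow> 's"
    and Q :: "int \<Rightarrow> nat \<Rightarrow> 's \<Rightarrow> 'a \<Rightarrow> 'w \<Rightarrow> real"
  assumes reward_laws: "\<And>s a. finite_variance_law (R s a)"
    and "N \<ge> 1" and "K \<ge> 1"
    and G1: "G_consistent N K G"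
    and G2: "G_nonexpansive N K G"
    and "prob_space M"
    and history: "filtration (space M) F" "\<And>t. subalgebra M (F t)"
    and samples_adapted:
      "\<And>t s a. r t s a \<in> F (Suc t) \<rightarrow>\<^sub>M borel"
      "\<And>t s a. f t s a \<in> F (Suc t) \<rightarrow>\<^sub>M count_space UNIV"
    and samples_law:
      "\<And>t. has_cond_law M (F t)
              (\<lambda>\<omega>. \<lambda>(s, a). (r t s a \<omega>, f t s a \<omega>))
              (\<Pi>\<^sub>M (s, a)\<in>UNIV. R s a \<Otimes>\<^sub>M measure_pmf (p s a))"
    and step_measurable:
      "\<And>t i s a. i \<in> {1..N} \<Longrightarrow> \<alpha> t i s a \<in> F t \<rightarrow>\<^sub>M borel"
    and step_range:
      "\<And>t i s a \<omega>. i \<in> {1..N} \<Longrightarrow> \<omega> \<in> space M \<Longrightarrow> 0 \<le> \<alpha> t i s a \<omega> \<and> \<alpha> t i s a \<omega> \<le> 1"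
    and step_squares:
      "\<And>i s a. i \<in> {1..N} \<Longrightarrow>
         AE \<omega> in M. summable (\<lambda>t. (\<alpha> t i s a \<omega>)\<^sup>2) \<and> (\<Sum>t. (\<alpha> t i s a \<omega>)\<^sup>2) \<le> C"
    and step_diverges:
      "\<And>i s a. i \<in> {1..N} \<Longrightarrow>
         AE \<omega> in M. filterlim (\<lambda>n. \<Sum>t<n. \<alpha> t i s a \<omega>) at_top sequentially"
    and initial_measurable:
      "\<And>\<tau> i s a. \<tau> \<in> {- int K + 1..0} \<Longrightarrow> i \<in> {1..N} \<Longrightarrow> Q \<tau> i s a \<in> F 0 \<rightarrow>\<^sub>M borel"
    and iteration:
      "\<And>t i s a \<omega>. i \<in> {1..N} \<Longrightarrow> \<omega> \<in> space M \<Longrightarrow>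
         Q (int t + 1) i s a \<omega> =
           Q (int t) i s a \<omega> +
           \<alpha> t i s a \<omega> *
             (r t s a \<omega> + \<gamma> * G (\<lambda>b k j. Q (int t - int j) k (f t s a \<omega>) b \<omega>)
              - Q (int t) i s a \<omega>)"
    and cases:
      "(0 \<le> \<gamma> \<and> \<gamma> < 1) \<or>
       (\<gamma> = 1 \<and>
        (\<exists>s\<^sub>1. absorbing_reward_free p R s\<^sub>1 \<and>
          (\<forall>\<tau>\<in>{- int K + 1..0}. \<forall>i\<in>{1..N}. \<forall>a. \<forall>\<omega>\<in>space M. Q \<tau> i s\<^sub>1 a \<omega> = 0) \<and>
          (\<forall>\<pi>. proper_policy p s\<^sub>1 \<pi>)))"
  shows "AE \<omega> in M. \<forall>i\<in>{1..N}. \<forall>s a. (\<lambda>t. Q (int t) i s a \<omega>) \<longlonglongrightarrow> opt_q p R \<gamma> s a"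
proof -
  have q_learning: "generalized_q_learning p R \<gamma> \<beta> \<xi> M C N K G F \<alpha> r f Q"
    if "weighted_mdp p R \<gamma> \<beta> \<xi>"
      and "\<And>\<tau> i s a \<omega>. \<xi> s = 0 \<Longrightarrow> \<tau> \<in> {- int K + 1..0} \<Longrightarrow> i \<in> {1..N} \<Longrightarrow> \<omega> \<in> space M \<Longrightarrow> Q \<tau> i s a \<omega> = 0"
      and "\<And>s a. \<xi> s = 0 \<Longrightarrow> AE x in R s a. x = 0" for \<beta> \<xi>
    by (intro generalized_q_learning.intro generalized_q_learning_axioms.intro that assms(2-17))
  from cases show ?thesis
  proof (elim disjE conjE exE)
    assume "0 \<le> \<gamma>" "\<gamma> < 1"
    then have "generalized_q_learning p R \<gamma> \<gamma> (\<lambda>_. 1) M C N K G F \<alpha> r f Q"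
      by (intro q_learning weighted_mdp_discounted reward_laws) simp_all
    then show ?thesis by (rule generalized_q_learning.Q_tendsto)
  next
    fix s\<^sub>1
    assume \<gamma>: "\<gamma> = 1" and absorbing: "absorbing_reward_free p R s\<^sub>1"
      and initial: "\<forall>\<tau>\<in>{- int K + 1..0}. \<forall>i\<in>{1..N}. \<forall>a. \<forall>\<omega>\<in>space M. Q \<tau> i s\<^sub>1 a \<omega> = 0"
      and proper: "\<forall>\<pi>. proper_policy p s\<^sub>1 \<pi>"
    have proper': "proper_policy p s\<^sub>1 \<pi>" and absorbing': "pmf (p s\<^sub>1 a) s\<^sub>1 = 1" for \<pi> a
      using proper absorbing by (simp_all add: absorbing_reward_free_def)
    obtain \<beta> \<xi> where \<beta>: "0 \<le> \<beta>" "\<beta> < 1" and \<xi>: "\<And>s. 0 \<le> \<xi> s" "\<And>s. \<xi> s = 0 \<longleftrightarrow> s = s\<^sub>1"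
      "\<And>s a. (\<Sum>s'\<in>UNIV. pmf (p s a) s' * \<xi> s') \<le> \<beta> * \<xi> s"
      by (rule proper_imp_weight[OF proper' absorbing']) (rule that)
    have AE_0: "AE x in R s a. x = 0" if "\<xi> s = 0" for s a
      using absorbing that unfolding \<xi>(2) absorbing_reward_free_def by blast
    have "mean_reward R s a = 0" if "\<xi> s = 0" for s a
      unfolding mean_reward_def by (rule integral_eq_zero_AE[OF AE_0[OF that]])
    then have "weighted_mdp p R \<gamma> \<beta> \<xi>"
      using \<beta> \<xi> by unfold_locales (simp_all add: \<gamma> reward_laws)
    then have "generalized_q_learning p R \<gamma> \<beta> \<xi> M C N K G F \<alpha> r f Q"
      by (rule q_learning) (use initial \<xi>(2) AE_0 in auto)
    then show ?thesis by (rule generalized_q_learning.Q_tendsto)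
  qed
qed

end
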